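(* Let $Q\in\{2,3,4\}$ and let $A\in\mathbb{C}$ be any solution of $A^2+A^{-2}+\sqrt{Q}=0$. Then the function $F\to\mathbb{C}$, $g\mapsto\langle g\rangle(A)$, is of positive type on the Thompson group $F$, where for $g=g(T_+,T_-)$ with $T_+,T_-\in\mathcal{T}_n$ one sets $\langle g\rangle(A)=(-A^2-A^{-2})^{-n}\,\langle L(T_+,T_-)\rangle(A)$.
   Context: **Trees and the Thompson group.** $\mathcal{T}_n$ is the set of rooted planar binary trees (every internal vertex has a left and a right child) with $n$ leaves, the leaves being numbered $1,\dots,n$ from left to right. To the root associate $[0,1]$ and, recursively, to the left/right child of a vertex with interval $I$ the left/right half of $I$; the leaves of $T\in\mathcal{T}_n$ then give a subdivision of $[0,1]$ into $n$ standard dyadic intervals. For $T_+,T_-\in\mathcal{T}_n$, $g(T_+,T_-)$ is the homeomorphism of $[0,1]$ mapping, for each $k$, the interval of the $k$-th leaf of $T_-$ linearly and increasingly onto the interval of the $k$-th leaf of $T_+$. The group $F$ (under composition) consists of all these homeomorphisms; $g(T_+,T_-)^{-1}=g(T_-,T_+)$. Two pairs of trees define the same element of $F$ iff they are connected by a sequence of additions/deletions of opposite carets (adding a pair of opposite carets means: for some $k$, attach to the $k$-th leaf of both trees two children). **The signed graph $\Gamma(T_+,T_-)$.** For $T\in\mathcal{T}_n$ let $\Gamma_\pm(T)$ be the following tree on the vertices $0,1,\dots,n-1$ (vertex $k\geq 1$ lies between leaves $k$ and $k+1$, vertex $0$ lies to the left of leaf $1$): for every internal vertex $v$ of $T$ whose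 left subtree has leaves $a,\dots,m$ and whose right subtree has leaves $m+1,\dots,b$ there is one edge joining $a-1$ and $m$. (This is the part of the dual graph of $T$ given by the edges of $T$ going from a left child up to its parent.) $\Gamma(T_+,T_-)$ is the signed planar multigraph on the vertices $0,\dots,n-1$ (placed in order on the $x$-axis) obtained as the union of $\Gamma_+(T_+)$, drawn by non-crossing arches in the upper half plane with edges signed $+$, and $\Gamma_-(T_-)$, drawn by non-crossing arches in the lower half plane with edges signed $-$; parallel edges are kept. **The link diagram $L(T_+,T_-)$.** Take the medial graph of the plane graph $\Gamma(T_+,T_-)$: the 4-regular plane graph with one vertex at the midpoint of each edge of $\Gamma$, in which midpoints of edges that are consecutive along the boundary of a face are joined by an arc inside that face (for a single vertex without edges take a circle). At the midpoint of an edge the arch is horizontal and the two strands of the medial graph cross there with slopes $+1$ and $-1$. Turn each medial vertex into a crossing: for $+$ edges (upper half plane) the strand of slope $+1$ passes over; for $-$ edges (lower half plane) the strand of slope $-1$ passes over. The result is the unoriented link diagram $L(T_+,T_-)$. **Kauffman bracket.** The Kauffman bracket $\langle D\rangle(A)$ of an unoriented link diagram $D$ is determined by: $\langle O\rangle=1$ for the crossingless circle $O$; $\langle D\cup O\rangle=(-A^2-A^{-2})\langle D\rangle$ for a disjoint crossingless circle; and $\langle D\rangle=A\langle D'\rangle+A^{-1}\langle D''\rangle$, where, at a crossing whose over strand is drawn with slope $+1$ and under strand with slope $-1$, $D'$ is obtained by replacing the crossing by two vertical arcs $)($ and $D''$ by replacing it by two horizontal arcs $\asymp$. The value $\langle g\rangle(A)$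 does not depend on the choice of the pair $(T_+,T_-)$ representing $g$. **Positive type.** A function $\phi:G\to\mathbb{C}$ on a discrete group $G$ is of positive type if for all $r$ and all $g_1,\dots,g_r\in G$ the matrix $(\phi(g_ig_j^{-1}))_{i,j=1}^r$ is positive semidefinite (in particular Hermitian). *)

theory Defs
  imports Complex_Main "HOL-Algebra.Bij"
begin

section \<open>Binary trees and the Thompson group\<close>

datatype btree = Leaf | Node btree btree

fun leaves :: "btree \<Rightarrow> nat" where
  "leaves Leaf = 1"
| "leaves (Node l r) = leaves l + leaves r"

fun intervals_from :: "real \<Rightarrow> real \<Rightarrow> btree \<Rightarrow> (real \<times> real) list" where
  "intervals_from a b Leaf = [(a, b)]"
| "intervals_from a b (Node l r) =
     intervals_from a ((a + b) / 2) l @ intervals_from ((a + b) / 2) b r"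

definition leaf_interval :: "btree \<Rightarrow> nat \<Rightarrow> real \<times> real" where
  "leaf_interval T k = intervals_from 0 1 T ! k"

fun affine_map :: "real \<times> real \<Rightarrow> real \<times> real \<Rightarrow> real \<Rightarrow> real" where
  "affine_map (a, b) (c, d) x = c + (x - a) / (b - a) * (d - c)"

text \<open>
  The homeomorphism \<open>g(T\<^sub>+, T\<^sub>-)\<close>, with leaves counted from \<open>0\<close>.  At a common endpoint of
  two leaf intervals both affine formulas agree, so taking the leftmost interval that
  contains \<open>x\<close> is only a convention.  Outside \<open>[0,1]\<close> the function is \<open>undefined\<close>, as the
  elements of \<^const>\<open>BijGroup\<close> are required to be.
\<close>

definition thompson_map :: "btree \<Rightarrow> btree \<Rightarrow> real \<Rightarrow> real" where
  "thompson_map Tp Tm = (\<lambda>x\<in>{0..1}.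
     let k = (LEAST k. k < leaves Tm \<and> x \<in> {fst (leaf_interval Tm k)..snd (leaf_interval Tm k)})
     in affine_map (leaf_interval Tm k) (leaf_interval Tp k) x)"

definition thompson_F :: "(real \<Rightarrow> real) monoid" where
  "thompson_F = (BijGroup {0..1})
     \<lparr>carrier := {thompson_map Tp Tm | Tp Tm. leaves Tp = leaves Tm}\<rparr>"


section \<open>The signed plane graph of a pair of trees\<close>

datatype sign = Pos | Neg

text \<open>
  The edge \<open>(s, a, b)\<close> with \<open>a < b\<close> joins the points \<open>a\<close> and \<open>b\<close> of the \<open>x\<close>-axis by an arch
  in the upper (\<open>s = Pos\<close>) or lower (\<open>s = Neg\<close>) half plane.
\<close>

type_synonym edge = "sign \<times> nat \<times> nat"

text \<open>
  \<open>arches k T\<close> lists the edges contributed by a subtree \<open>T\<close> whose leaves are numbered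
  \<open>k + 1, \<dots>, k + leaves T\<close>; thus \<open>a - 1 = k\<close> and \<open>m = k + leaves l\<close> at its root.
\<close>

fun arches :: "nat \<Rightarrow> btree \<Rightarrow> (nat \<times> nat) list" where
  "arches k Leaf = []"
| "arches k (Node l r) = (k, k + leaves l) # arches k l @ arches (k + leaves l) r"

text \<open>
  The arches of one tree have pairwise different right endpoints, so a parallel pair of edges
  always consists of one \<open>Pos\<close> and one \<open>Neg\<close> edge, and edges are determined by their labels.
\<close>

definition signed_graph :: "btree \<Rightarrow> btree \<Rightarrow> edge list" where
  "signed_graph Tp Tm = map (Pair Pos) (arches 0 Tp) @ map (Pair Neg) (arches 0 Tm)"

datatype edge_end = LeftEnd edge | RightEnd edge

definition right_neighbours :: "edge list \<Rightarrow> sign \<Rightarrow> nat \<Rightarrow> nat list" where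
  "right_neighbours E s v = sorted_list_of_set {b. (s, v, b) \<in> set E}"

definition left_neighbours :: "edge list \<Rightarrow> sign \<Rightarrow> nat \<Rightarrow> nat list" where
  "left_neighbours E s v = sorted_list_of_set {a. (s, a, v) \<in> set E}"

text \<open>
  The edge ends at the vertex \<open>v\<close> in counterclockwise order, starting from the positive
  \<open>x\<close>-direction: upper arches to the right (innermost first), upper arches to the left
  (outermost first), lower arches to the left (innermost first), lower arches to the right
  (outermost first).
\<close>

definition rotation :: "edge list \<Rightarrow> nat \<Rightarrow> edge_end list" where
  "rotation E v =
     map (\<lambda>b. LeftEnd (Pos, v, b)) (right_neighbours E Pos v) @
     map (\<lambda>a. RightEnd (Pos, a, v)) (left_neighbours E Pos v) @
     map (\<lambda>a. RightEnd (Neg, a, v)) (rev (left_neighbours E Neg v)) @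
     map (\<lambda>b. LeftEnd (Neg, v, b)) (rev (right_neighbours E Neg v))"


section \<open>Link diagrams and the Kauffman bracket\<close>

text \<open>
  An unoriented link diagram is encoded by its crossings and the arcs between them (a
  planar-diagram code).  \<open>Crossing sw se ne nw\<close> carries the labels of the four ends at a crossing,
  in counterclockwise order, when the crossing is turned so that the over strand \<open>sw\<close>--\<open>ne\<close> has
  slope \<open>+1\<close> and the under strand \<open>nw\<close>--\<open>se\<close> has slope \<open>-1\<close>.  An arc is the pair of labels that
  it connects; a crossingless circle may be given as an arc from a label to itself.
\<close>

datatype 'p crossing = Crossing 'p 'p 'p 'p

type_synonym 'p diagram = "'p crossing list \<times> ('p \<times> 'p) list"

text \<open>The circles of a diagram without crossings are the connected components of its arcs.\<close>

definition circles :: "('p \<times> 'p) set \<Rightarrow> nat" where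
  "circles R = card (Field R // ((R \<union> R\<inverse>)\<^sup>* \<inter> Field R \<times> Field R))"

definition loop_value :: "complex \<Rightarrow> complex" where
  "loop_value A = - (A ^ 2) - inverse (A ^ 2)"

text \<open>
  The second equation resolves the first crossing by the two vertical arcs, respectively the
  two horizontal arcs.  When no crossing is left, the diagram consists of \<open>c \<ge> 1\<close> disjoint
  circles, whose bracket is \<open>(- A\<^sup>2 - A\<^sup>-\<^sup>2)\<close> to the power \<open>c - 1\<close>.  The lemmas below show that
  the three defining properties of the bracket hold.
\<close>

fun bracket :: "complex \<Rightarrow> 'p crossing list \<Rightarrow> ('p \<times> 'p) list \<Rightarrow> complex" where
  "bracket A [] R = loop_value A ^ (circles (set R) - 1)"
| "bracket A (Crossing sw se ne nw # cs) R =
     A * bracket A cs ((sw, nw) # (se, ne) # R) +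
     inverse A * bracket A cs ((nw, ne) # (sw, se) # R)"

definition kauffman_bracket :: "'p diagram \<Rightarrow> complex \<Rightarrow> complex" where
  "kauffman_bracket D A = bracket A (fst D) (snd D)"

lemma circles_insert_loop:
  assumes "finite R" "p \<notin> Field R"
  shows "circles (insert (p, p) R) = Suc (circles R)"
proof -
  let ?S = "\<lambda>R. (R \<union> R\<inverse>)\<^sup>* \<inter> Field R \<times> Field R"
  let ?R = "insert (p, p) R"
  have F: "Field ?R = insert p (Field R)" by (auto simp: Field_def)
  have "?R \<union> ?R\<inverse> = insert (p, p) (R \<union> R\<inverse>)" by auto
  moreover have "(insert (p, p) (R \<union> R\<inverse>))\<^sup>* = (R \<union> R\<inverse>)\<^sup>*"
  proof -
    have "(insert (p, p) (R \<union> R\<inverse>))\<^sup>* = ((R \<union> R\<inverse>) \<union> Id)\<^sup>*"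
      by (rule antisym; rule rtrancl_subset_rtrancl) auto
    then show ?thesis by simp
  qed
  ultimately have eq: "(?R \<union> ?R\<inverse>)\<^sup>* = (R \<union> R\<inverse>)\<^sup>*" by simp
  have closed: "y \<in> Field R \<longleftrightarrow> x \<in> Field R" if "(x, y) \<in> (R \<union> R\<inverse>)\<^sup>*" for x y
    using that by (induction rule: rtrancl_induct) (auto simp: Field_def)
  have isolated: "(p, y) \<in> (R \<union> R\<inverse>)\<^sup>* \<longleftrightarrow> y = p" for y
  proof
    assume "(p, y) \<in> (R \<union> R\<inverse>)\<^sup>*"
    then show "y = p"
      using assms(2) by (cases rule: converse_rtranclE) (auto simp: Field_def)
  qed auto
  have p: "?S ?R `` {p} = {p}"
    unfolding eq F using isolated by auto
  have x: "?S ?R `` {x} = ?S R `` {x}" if "x \<in> Field R" for x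
    unfolding eq F using that closed assms(2) by blast
  have "Field ?R // ?S ?R = insert {p} (Field R // ?S R)"
    unfolding quotient_def F using p x unfolding F by auto
  moreover have "{p} \<notin> Field R // ?S R"
    using assms(2) by (auto simp: quotient_def)
  moreover have "finite (Field R // ?S R)"
    using assms(1) by (simp add: quotient_def finite_Field)
  ultimately show ?thesis by (simp add: circles_def)
qed

lemma circles_pos:
  assumes "finite R" "R \<noteq> {}"
  shows "0 < circles R"
proof -
  have "Field R \<noteq> {}" using assms(2) by (force simp: Field_def)
  then show ?thesis
    using assms(1) by (simp add: circles_def card_gt_0_iff quotient_def finite_Field)
qed

lemma bracket_cong: "set R = set R' \<Longrightarrow> bracket A cs R = bracket A cs R'"
proof (induction A cs R arbitrary: R' rule: bracket.induct)
  case (1 A R)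
  then show ?case by simp
next
  case (2 A sw se ne nw cs R)
  have "bracket A cs ((sw, nw) # (se, ne) # R) = bracket A cs ((sw, nw) # (se, ne) # R')"
    by (rule 2(1)) (simp add: 2(3))
  moreover have "bracket A cs ((nw, ne) # (sw, se) # R) = bracket A cs ((nw, ne) # (sw, se) # R')"
    by (rule 2(2)) (simp add: 2(3))
  ultimately show ?case by (simp only: bracket.simps)
qed

lemma kauffman_bracket_circle: "kauffman_bracket ([], [(p, p)]) A = 1"
  using circles_insert_loop[of "{}" p]
  by (simp add: kauffman_bracket_def circles_def)

lemma kauffman_bracket_disjoint_circle:
  assumes "\<And>c. c \<in> set cs \<Longrightarrow> p \<notin> set_crossing c" "p \<notin> Field (set R)"
    and "cs \<noteq> [] \<or> R \<noteq> []"
  shows "kauffman_bracket (cs, (p, p) # R) A = loop_value A * kauffman_bracket (cs, R) A"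
proof -
  have "bracket A cs ((p, p) # R) = loop_value A * bracket A cs R"
    using assms
  proof (induction A cs R rule: bracket.induct)
    case (1 A R)
    then have "0 < circles (set R)" by (intro circles_pos) auto
    with 1 show ?case
      by (simp add: circles_insert_loop flip: power_Suc)
  next
    case (2 A sw se ne nw cs R)
    have p: "p \<notin> {sw, se, ne, nw}"
      using 2(3)[of "Crossing sw se ne nw"] by auto
    have cs: "p \<notin> set_crossing c" if "c \<in> set cs" for c
      using 2(3) that by auto
    have "bracket A cs ((p, p) # (sw, nw) # (se, ne) # R) =
        loop_value A * bracket A cs ((sw, nw) # (se, ne) # R)"
      using p cs 2(4) by (intro 2(1)) (auto simp: Field_def)
    moreover have "bracket A cs ((p, p) # (nw, ne) # (sw, se) # R) =
        loop_value A * bracket A cs ((nw, ne) # (sw, se) # R)"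
      using p cs 2(4) by (intro 2(2)) (auto simp: Field_def)
    moreover have "bracket A cs ((sw, nw) # (se, ne) # (p, p) # R) =
        bracket A cs ((p, p) # (sw, nw) # (se, ne) # R)"
      "bracket A cs ((nw, ne) # (sw, se) # (p, p) # R) =
        bracket A cs ((p, p) # (nw, ne) # (sw, se) # R)"
      by (rule bracket_cong; auto)+
    ultimately show ?case by (simp add: algebra_simps)
  qed
  then show ?thesis by (simp add: kauffman_bracket_def)
qed

lemma kauffman_bracket_skein:
  "kauffman_bracket (cs @ Crossing sw se ne nw # cs', R) A =
     A * kauffman_bracket (cs @ cs', (sw, nw) # (se, ne) # R) A +
     inverse A * kauffman_bracket (cs @ cs', (nw, ne) # (sw, se) # R) A"
proof -
  have "bracket A (cs @ Crossing sw se ne nw # cs') R =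
     A * bracket A (cs @ cs') ((sw, nw) # (se, ne) # R) +
     inverse A * bracket A (cs @ cs') ((nw, ne) # (sw, se) # R)"
  proof (induction A cs R rule: bracket.induct)
    case (2 A a b c d cs R)
    have swap: "bracket A (cs @ cs') (x # y # z # w # R) = bracket A (cs @ cs') (z # w # x # y # R)"
      for x y z w by (rule bracket_cong) auto
    show ?case
      using 2 swap[of "(sw, nw)" "(se, ne)"] swap[of "(nw, ne)" "(sw, se)"]
      by (simp add: algebra_simps)
  qed simp
  then show ?thesis by (simp add: kauffman_bracket_def)
qed


section \<open>The link diagram of a pair of trees\<close>

text \<open>
  \<open>Strand e c\<close> is the end in direction \<open>c\<close> of the two medial strands crossing at the midpoint
  of the edge \<open>e\<close>; \<open>Loop v\<close> labels the circle around a vertex \<open>v\<close> without edges.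
\<close>

datatype direction = SW | SE | NE | NW

datatype label = Strand edge direction | Loop nat

text \<open>
  For a \<open>Neg\<close> edge the strand from \<open>NW\<close> to \<open>SE\<close> passes over; a quarter turn brings it to
  slope \<open>+1\<close>.
\<close>

fun edge_crossing :: "edge \<Rightarrow> label crossing" where
  "edge_crossing (Pos, e) = Crossing (Strand (Pos, e) SW) (Strand (Pos, e) SE)
     (Strand (Pos, e) NE) (Strand (Pos, e) NW)"
| "edge_crossing (Neg, e) = Crossing (Strand (Neg, e) NW) (Strand (Neg, e) SW)
     (Strand (Neg, e) SE) (Strand (Neg, e) NE)"

text \<open>
  The medial strand that, seen from a vertex, runs along the counterclockwise (respectively
  clockwise) side of an edge leaving it: the edge leaves its left end heading east, and its
  right end heading west.
\<close>

fun ccw_side :: "edge_end \<Rightarrow> label" where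
  "ccw_side (LeftEnd e) = Strand e NW"
| "ccw_side (RightEnd e) = Strand e SE"

fun cw_side :: "edge_end \<Rightarrow> label" where
  "cw_side (LeftEnd e) = Strand e SW"
| "cw_side (RightEnd e) = Strand e NE"

text \<open>
  Two edges are consecutive along the boundary of a face at a corner of that face, that is, at
  a vertex \<open>v\<close> where their ends are consecutive in the cyclic order around \<open>v\<close>; the medial arc
  cuts off this corner.  (At a vertex of degree one it joins the edge to itself.)
\<close>

definition corner_arcs :: "edge list \<Rightarrow> nat \<Rightarrow> (label \<times> label) list" where
  "corner_arcs E v =
     (if rotation E v = [] then [(Loop v, Loop v)]
      else map (\<lambda>(d, d'). (ccw_side d, cw_side d')) (zip (rotation E v) (rotate1 (rotation E v))))"

definition link_diagram :: "btree \<Rightarrow> btree \<Rightarrow> label diagram" where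
  "link_diagram Tp Tm =
     (let E = signed_graph Tp Tm
      in (map edge_crossing E, concat (map (corner_arcs E) [0..<leaves Tp])))"


section \<open>The bracket as a function on the Thompson group\<close>

definition thompson_bracket :: "complex \<Rightarrow> (real \<Rightarrow> real) \<Rightarrow> complex" where
  "thompson_bracket A g = (THE z. \<exists>Tp Tm. leaves Tp = leaves Tm \<and> g = thompson_map Tp Tm \<and>
     z = inverse (loop_value A ^ leaves Tp) * kauffman_bracket (link_diagram Tp Tm) A)"


section \<open>Functions of positive type\<close>

definition positive_semidefinite :: "nat \<Rightarrow> (nat \<Rightarrow> nat \<Rightarrow> complex) \<Rightarrow> bool" where
  "positive_semidefinite r M \<longleftrightarrow>
     (\<forall>i<r. \<forall>j<r. M j i = cnj (M i j)) \<and>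
     (\<forall>c. 0 \<le> Re (\<Sum>i<r. \<Sum>j<r. cnj (c i) * M i j * c j))"

definition positive_type :: "('a, 'b) monoid_scheme \<Rightarrow> ('a \<Rightarrow> complex) \<Rightarrow> bool" where
  "positive_type G \<phi> \<longleftrightarrow>
     (\<forall>r (g :: nat \<Rightarrow> 'a). (\<forall>i<r. g i \<in> carrier G) \<longrightarrow>
        positive_semidefinite r (\<lambda>i j. \<phi> (g i \<otimes>\<^bsub>G\<^esub> inv\<^bsub>G\<^esub> (g j))))"

end

theory Submission
  imports Defs
begin

text \<open>
  Since \<open>A\<^sup>2 + A\<^sup>-\<^sup>2\<close> is real of modulus at most \<open>2\<close>, we have \<open>\<bar>A\<bar> = 1\<close>.  Expand the bracket over all
  states: smoothing the crossings of an edge set \<open>S\<close> one way and the others the other way leaves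
  \<open>2 k(S) + \<bar>S\<bar> - n\<close> circles, where \<open>k(S)\<close> is the number of components of \<open>({0..n - 1}, S)\<close>.  As
  \<open>\<delta>\<^sup>2 = Q\<close> for the loop value \<open>\<delta>\<close>, the bracket is, up to a power of \<open>\<delta>\<close>, the Potts partition
  function, a sum over the colourings of the vertices by \<open>Q\<close> colours of a product of edge weights.
  The weights of the negative edges are the complex conjugates of those of the positive edges.
  Hence the value at \<open>g(T\<^sub>+, T\<^sub>-)\<close> is a positive multiple of the inner product of a vector depending
  on \<open>T\<^sub>+\<close> with the same kind of vector depending on \<open>T\<^sub>-\<close>.  All weights have modulus one, so opposite
  carets cancel.  Finitely many elements can be written with a common second tree \<open>U\<close>, and then
  \<open>g(T\<^sub>i, U) g(T\<^sub>j, U)\<^sup>-\<^sup>1 = g(T\<^sub>i, T\<^sub>j)\<close> yields a Gram matrix.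
\<close>

section \<open>Thompson's group\<close>

text \<open>
  The increasing bijection \<open>[0, n] \<rightarrow> [0, 1]\<close> that maps \<open>[k, k + 1]\<close> affinely onto the \<open>k\<close>-th
  leaf interval, so that \<open>g(T\<^sub>+, T\<^sub>-) = leaf_param T\<^sub>+ \<circ> (leaf_param T\<^sub>-)\<^sup>-\<^sup>1\<close>.
\<close>

fun leaf_param :: "btree \<Rightarrow> real \<Rightarrow> real" where
  "leaf_param Leaf y = y"
| "leaf_param (Node l r) y =
     (if y \<le> leaves l then leaf_param l y / 2 else (1 + leaf_param r (y - leaves l)) / 2)"

section \<open>The leaf parametrization as an increasing bijection\<close>

lemma leaves_pos [simp]: "0 < leaves T"
  by (induction T) auto

lemma leaves_eq_Suc_0: "leaves T = Suc 0 \<longleftrightarrow> T = Leaf"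
proof (cases T)
  case (Node l r)
  then show ?thesis using leaves_pos[of l] leaves_pos[of r] by (auto simp del: leaves_pos)
qed auto

lemma leaf_param_0 [simp]: "leaf_param T 0 = 0"
  by (induction T) auto

lemma leaf_param_leaves [simp]: "leaf_param T (leaves T) = 1"
proof (induction T)
  case (Node l r)
  then show ?case using leaves_pos[of r] by (auto simp del: leaves_pos)
qed auto

lemma leaf_param_less: "x < y \<Longrightarrow> leaf_param T x < leaf_param T y"
proof (induction T arbitrary: x y)
  case (Node l r)
  consider "y \<le> leaves l" | "x \<le> leaves l" "leaves l < y" | "leaves l < x"
    using Node.prems by linarith
  then show ?case
  proof cases
    \<comment> \<open>The points lie on opposite sides of the split, so their images are separated
      by 1/2.\<close>
    case 2
    have "leaf_param l x \<le> 1"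
      using Node.IH(1)[of x "leaves l"] 2(1) by (cases "x = leaves l") auto
    moreover have "0 < leaf_param r (y - leaves l)"
      using Node.IH(2)[of 0 "y - leaves l"] 2(2) by simp
    ultimately show ?thesis using 2 by simp
  qed (use Node in auto)
qed auto

lemma leaf_param_less_iff [simp]: "leaf_param T x < leaf_param T y \<longleftrightarrow> x < y"
  using leaf_param_less[of x y T] leaf_param_less[of y x T] by (cases x y rule: linorder_cases) auto

lemma leaf_param_le_iff [simp]: "leaf_param T x \<le> leaf_param T y \<longleftrightarrow> x \<le> y"
  by (meson leaf_param_less_iff not_le)

lemma leaf_param_eq_iff [simp]: "leaf_param T x = leaf_param T y \<longleftrightarrow> x = y"
  by (metis leaf_param_le_iff order_antisym order_refl)

text \<open>The clauses of \<open>leaf_param\<close> make sense on the whole real line, so the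
  induction needs no range condition; the unit interval is recovered from the values at the two
  endpoints.\<close>

lemma leaf_param_surj: "\<exists>y. leaf_param T y = z"
proof (induction T arbitrary: z)
  case (Node l r)
  obtain u v where u: "leaf_param l u = 2 * z" and v: "leaf_param r v = 2 * z - 1"
    using Node by meson
  show ?case
  proof (cases "z \<le> 1 / 2")
    case True
    then have "leaf_param l u \<le> leaf_param l (leaves l)" using u by simp
    then have "u \<le> leaves l" by (simp del: leaf_param_leaves)
    then show ?thesis using u by (intro exI[of _ u]) simp
  next
    case False
    then have "leaf_param r 0 < leaf_param r v" using v by simp
    then have "0 < v" by (simp del: leaf_param_0)
    then show ?thesis using v by (intro exI[of _ "leaves l + v"]) simp
  qed
qed auto

lemma leaf_param_in_01_iff [simp]: "leaf_param T y \<in> {0..1} \<longleftrightarrow> y \<in> {0..real (leaves T)}"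
  using leaf_param_le_iff[of T 0 y] leaf_param_le_iff[of T y "leaves T"]
  by (simp del: leaf_param_le_iff)

lemma leaf_param_surj_01:
  assumes "x \<in> {0..1}"
  obtains y where "y \<in> {0..real (leaves T)}" "x = leaf_param T y"
  by (metis assms leaf_param_in_01_iff leaf_param_surj)

lemma leaf_param_affine:
  assumes "k < leaves T" "0 \<le> t" "t \<le> 1"
  shows "leaf_param T (k + t) = leaf_param T k + t * (leaf_param T (k + 1) - leaf_param T k)"
  using assms
proof (induction T arbitrary: k)
  case (Node l r)
  show ?case
  proof (cases "k < leaves l")
    case True
    then have "real k + 1 \<le> leaves l" by linarith
    then have "real k + t \<le> leaves l" using Node.prems by linarith
    then show ?thesis using Node.IH(1)[OF True] Node.prems \<open>real k + 1 \<le> leaves l\<close>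
      by (auto simp: field_simps)
  next
    case False
    then obtain j where j: "k = leaves l + j" by (metis le_Suc_ex not_less)
    \<comment> \<open>At the split itself the definition uses the left subtree; both formulas give
      1/2 there, so the right one is valid from the split on.\<close>
    have right: "leaf_param (Node l r) (real k + y) = (1 + leaf_param r (real j + y)) / 2"
      if "0 \<le> y" for y :: real
      using that by (cases "j = 0 \<and> y = 0") (auto simp: j)
    have right0: "leaf_param (Node l r) k = (1 + leaf_param r j) / 2" using right[of 0] by simp
    have IH: "leaf_param r (real j + t) =
        leaf_param r j + t * (leaf_param r (real j + 1) - leaf_param r j)"
      using Node.IH(2)[of j] Node.prems by (simp add: j)
    have "leaf_param (Node l r) (real k + t) = (1 + leaf_param r (real j + t)) / 2"
      by (rule right) fact
    moreover have "leaf_param (Node l r) (real k + 1) = (1 + leaf_param r (real j + 1)) / 2"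
      by (rule right) simp
    ultimately show ?thesis
      unfolding right0 IH by (simp add: field_simps del: leaf_param.simps)
  qed
qed simp

section \<open>Leaf intervals and tree-pair maps in terms of the parametrization\<close>

lemma length_intervals_from [simp]: "length (intervals_from a b T) = leaves T"
  by (induction T arbitrary: a b) auto

lemma nth_intervals_from:
  "k < leaves T \<Longrightarrow> intervals_from a b T ! k =
     (a + (b - a) * leaf_param T k, a + (b - a) * leaf_param T (k + 1))"
proof (induction T arbitrary: a b k)
  case (Node l r)
  show ?case
  proof (cases "k < leaves l")
    case True
    then have "real k + 1 \<le> leaves l" by linarith
    then show ?thesis using Node.IH(1)[OF True] Node.prems True
      by (auto simp: nth_append field_simps)
  next
    case False
    then obtain j where j: "k = leaves l + j" by (metis le_Suc_ex not_less)
    have right: "leaf_param (Node l r) (real k + y) = (1 + leaf_param r (real j + y)) / 2"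
      if "0 \<le> y" for y :: real
      using that by (cases "j = 0 \<and> y = 0") (auto simp: j)
    have right0: "leaf_param (Node l r) k = (1 + leaf_param r j) / 2" using right[of 0] by simp
    have right1: "leaf_param (Node l r) (real k + 1) = (1 + leaf_param r (real j + 1)) / 2"
      by (rule right) simp
    have "intervals_from a b (Node l r) ! k = intervals_from ((a + b) / 2) b r ! j"
      by (simp add: j nth_append)
    then show ?thesis
      unfolding right0 right1 using Node.IH(2)[of j] Node.prems by (simp add: j field_simps)
  qed
qed simp

lemma leaf_interval_eq:
  "k < leaves T \<Longrightarrow> leaf_interval T k = (leaf_param T k, leaf_param T (k + 1))"
  by (simp add: leaf_interval_def nth_intervals_from)

text \<open>The interval picked by \<open>LEAST\<close> satisfies
  \<open>k \<le> y \<le> k + 1\<close>, and there both parametrizations are affine in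
  \<open>y - k\<close>. At a common endpoint either choice of interval would do.\<close>

lemma thompson_map_leaf_param:
  assumes "leaves Tp = leaves Tm" "y \<in> {0..real (leaves Tm)}"
  shows "thompson_map Tp Tm (leaf_param Tm y) = leaf_param Tp y"
proof -
  define x where "x = leaf_param Tm y"
  define P where "P k \<longleftrightarrow> k < leaves Tm \<and> x \<in> {fst (leaf_interval Tm k)..snd (leaf_interval Tm k)}" for k
  have P: "P k \<longleftrightarrow> k < leaves Tm \<and> real k \<le> y \<and> y \<le> k + 1" for k
    unfolding P_def x_def by (auto simp: leaf_interval_eq)
  have "\<exists>k. P k"
  proof (cases "y = leaves Tm")
    \<comment> \<open>At the right endpoint the floor of \<open>y\<close> is not a leaf index; the
      last interval contains the point.\<close>
    case True
    then show ?thesis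
      unfolding P using leaves_pos[of Tm] by (intro exI[of _ "leaves Tm - 1"]) (simp del: leaves_pos)
  next
    case False
    then have "nat \<lfloor>y\<rfloor> < leaves Tm" "real (nat \<lfloor>y\<rfloor>) \<le> y" "y \<le> nat \<lfloor>y\<rfloor> + 1"
      using assms(2) by (simp_all add: nat_less_iff floor_less_iff) linarith
    then show ?thesis unfolding P by blast
  qed
  then have "P (LEAST k. P k)" by (rule LeastI_ex)
  moreover define k where "k = (LEAST k. P k)"
  ultimately have k: "k < leaves Tm" "real k \<le> y" "y \<le> k + 1" unfolding P by auto
  have aff: "leaf_param T y = leaf_param T k + (y - k) * (leaf_param T (k + 1) - leaf_param T k)"
    if "leaves T = leaves Tm" for T
    using leaf_param_affine[of k T "y - k"] k that by simp
  have "leaf_param Tm k < leaf_param Tm (k + 1)" by simp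
  then have ne: "leaf_param Tm (k + 1) - leaf_param Tm k \<noteq> 0" by linarith
  have "thompson_map Tp Tm x = affine_map (leaf_interval Tm k) (leaf_interval Tp k) x"
    using assms(2) unfolding thompson_map_def k_def P_def x_def Let_def
    by (subst restrict_apply) (simp only: leaf_param_in_01_iff if_True)
  also have "\<dots> = leaf_param Tp y"
    using ne k(1) assms(1) aff[of Tm] by (simp add: leaf_interval_eq aff[of Tp] x_def)
  finally show ?thesis by (simp add: x_def)
qed

text \<open>The parameter of the point 1/2 is the number of leaves of the left subtree; the two
  halves then determine the subtrees.\<close>

lemma leaf_param_inject:
  assumes "leaves S = leaves T" "\<And>y. y \<in> {0..real (leaves T)} \<Longrightarrow> leaf_param S y = leaf_param T y"
  shows "S = T"
  using assms
proof (induction S arbitrary: T)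
  case Leaf
  then show ?case using leaves_eq_Suc_0[of T] by simp
next
  case (Node l r)
  show ?case
  proof (cases T)
    case Leaf
    then show ?thesis using Node.prems(1) leaves_pos[of l] leaves_pos[of r] by auto
  next
    case T: (Node l' r')
    have eq: "leaf_param (Node l r) y = leaf_param (Node l' r') y" if "0 \<le> y" "y \<le> leaves T" for y :: real
      using Node.prems(2) that by (simp add: T)
    have half: "leaf_param (Node a b) (leaves a) = 1 / 2" for a b by simp
    have "leaf_param (Node l' r') (leaves l) = leaf_param (Node l' r') (leaves l')"
      using half[of l r] half[of l' r'] eq[of "leaves l"] Node.prems(1)
      by (simp del: leaf_param.simps leaf_param_eq_iff)
    then have l: "leaves l = leaves l'"
      unfolding leaf_param_eq_iff by simp
    then have r: "leaves r = leaves r'" using Node.prems(1) T by simp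
    have "leaf_param l y = leaf_param l' y" if "y \<in> {0..real (leaves l')}" for y
      using eq[of y] that by (simp add: l T)
    moreover have "leaf_param r y = leaf_param r' y" if "y \<in> {0..real (leaves r')}" for y
    proof (cases "y = 0")
      case False
      then show ?thesis using eq[of "leaves l + y"] that by (simp add: l T)
    qed simp
    ultimately show ?thesis using Node.IH(1)[OF l] Node.IH(2)[OF r] T by simp
  qed
qed

text \<open>This turns equality of group elements into equality of trees, once both are written with
  the same second tree.\<close>

lemma thompson_map_inject:
  assumes "leaves Tp = leaves Tm" "leaves Sp = leaves Tm" "thompson_map Tp Tm = thompson_map Sp Tm"
  shows "Tp = Sp"
  using assms by (intro leaf_param_inject) (metis thompson_map_leaf_param)+

lemma thompson_map_undefined: "(x :: real) \<notin> {0..1} \<Longrightarrow> thompson_map Tp Tm x = undefined"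
  by (auto simp: thompson_map_def restrict_def)

section \<open>Composition and inverses of tree-pair maps\<close>

lemma thompson_map_in_Bij:
  assumes "leaves Tp = leaves Tm"
  shows "thompson_map Tp Tm \<in> Bij {0..1}"
proof -
  have "bij_betw (thompson_map Tp Tm) {0..1} {0..1}"
  proof (rule bij_betw_imageI)
    show "inj_on (thompson_map Tp Tm) {0..1}"
      by (rule inj_onI, erule leaf_param_surj_01[of _ Tm], erule leaf_param_surj_01[of _ Tm])
        (simp add: thompson_map_leaf_param assms)
    have sub: "thompson_map Tp Tm x \<in> {0..1}" if "x \<in> {0..1}" for x :: real
      using that by (rule leaf_param_surj_01[of x Tm])
        (simp only: thompson_map_leaf_param assms leaf_param_in_01_iff)
    have "x \<in> thompson_map Tp Tm ` {0..1}" if x: "x \<in> {0..1}" for x :: real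
    proof -
      obtain y where y: "y \<in> {0..real (leaves Tp)}" "x = leaf_param Tp y"
        using x by (rule leaf_param_surj_01)
      then have "leaf_param Tm y \<in> {0..1}" "x = thompson_map Tp Tm (leaf_param Tm y)"
        by (simp_all only: leaf_param_in_01_iff thompson_map_leaf_param assms)
      then show ?thesis by blast
    qed
    with sub show "thompson_map Tp Tm ` {0..1} = {0..1}" by blast
  qed
  then show ?thesis by (simp add: Bij_def extensional_def thompson_map_undefined)
qed

lemma thompson_map_compose:
  assumes "leaves Tp = leaves U" "leaves U = leaves Tm"
  shows "compose {0..1} (thompson_map Tp U) (thompson_map U Tm) = thompson_map Tp Tm"
proof
  fix x :: real
  show "compose {0..1} (thompson_map Tp U) (thompson_map U Tm) x = thompson_map Tp Tm x"
  proof (cases "x \<in> {0..1}")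
    case True
    then obtain y where "y \<in> {0..real (leaves Tm)}" "x = leaf_param Tm y" by (rule leaf_param_surj_01)
    then show ?thesis using assms True by (simp add: compose_eq thompson_map_leaf_param)
  next
    case False
    then show ?thesis using thompson_map_undefined[OF False] by (auto simp: compose_def)
  qed
qed

lemma thompson_map_refl: "thompson_map T T = (\<lambda>x\<in>{0..1}. x)"
proof
  fix x :: real
  show "thompson_map T T x = (\<lambda>x\<in>{0..1}. x) x"
  proof (cases "x \<in> {0..1}")
    case True
    then obtain y where "y \<in> {0..real (leaves T)}" "x = leaf_param T y" by (rule leaf_param_surj_01)
    then show ?thesis using True by (simp add: thompson_map_leaf_param)
  next
    case False
    then show ?thesis using thompson_map_undefined[OF False] by (auto simp: restrict_def)
  qed
qed

lemma thompson_map_mult: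
  assumes "leaves Tp = leaves U" "leaves U = leaves Tm"
  shows "thompson_map Tp U \<otimes>\<^bsub>BijGroup {0..1}\<^esub> thompson_map U Tm = thompson_map Tp Tm"
  using assms by (simp add: BijGroup_def thompson_map_in_Bij thompson_map_compose)

lemma thompson_map_inv_Bij:
  assumes "leaves Tp = leaves Tm"
  shows "inv\<^bsub>BijGroup {0..1}\<^esub> (thompson_map Tp Tm) = thompson_map Tm Tp"
proof -
  interpret group "BijGroup {0..1::real}" by (rule group_BijGroup)
  show ?thesis
    by (rule inv_equality)
      (use assms in \<open>simp_all add: thompson_map_mult\<close>,
       simp_all add: BijGroup_def thompson_map_in_Bij thompson_map_refl)
qed

section \<open>Refinement of trees\<close>

text \<open>The position \<open>k\<close> counts leaves from \<open>0\<close>; a position beyond the last leaf means the last one.\<close>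

fun add_caret :: "nat \<Rightarrow> btree \<Rightarrow> btree" where
  "add_caret k Leaf = Node Leaf Leaf"
| "add_caret k (Node l r) =
     (if k < leaves l then Node (add_caret k l) r else Node l (add_caret (k - leaves l) r))"

lemma leaves_add_caret [simp]: "leaves (add_caret k T) = Suc (leaves T)"
  by (induction T arbitrary: k) auto

text \<open>The change of parameter caused by a caret at leaf \<open>k\<close>: two unit intervals
  are compressed into one. It does not depend on the tree, which is why opposite carets
  cancel.\<close>

definition squeeze :: "nat \<Rightarrow> real \<Rightarrow> real" where
  "squeeze k y = (if y \<le> k then y else if y \<le> k + 2 then k + (y - k) / 2 else y - 1)"

lemma leaf_param_add_caret:
  fixes y :: real
  assumes "k < leaves T" "0 \<le> y" "y \<le> leaves T + 1"
  shows "leaf_param (add_caret k T) y = leaf_param T (squeeze k y)"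
  using assms
proof (induction T arbitrary: k y)
  case Leaf
  then show ?case by (auto simp: squeeze_def)
next
  case (Node l r)
  show ?case
  proof (cases "k < leaves l")
    case True
    then have k: "real k + 1 \<le> leaves l" by linarith
    show ?thesis
    proof (cases "y \<le> leaves l + 1")
      case y: True
      then have "squeeze k y \<le> leaves l" using k by (simp add: squeeze_def field_simps)
      then show ?thesis using Node.IH(1)[OF True Node.prems(2)] y True by simp
    next
      case False
      then have "squeeze k y = y - 1" using k by (auto simp: squeeze_def)
      then show ?thesis using False True by (simp add: algebra_simps)
    qed
  next
    case False
    then have k: "real (leaves l) \<le> k" by linarith
    show ?thesis
    proof (cases "y \<le> leaves l")
      case True
      then have "squeeze k y = y" using k by (auto simp: squeeze_def)
      then show ?thesis using False True by simp
    next
      case y: False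
      have "squeeze (k - leaves l) (y - leaves l) = squeeze k y - leaves l"
        using False by (auto simp: squeeze_def of_nat_diff)
      moreover have "leaves l < squeeze k y" using k y by (simp add: squeeze_def field_simps)
      ultimately show ?thesis
        using False y Node.IH(2)[of "k - leaves l" "y - leaves l"] Node.prems by auto
    qed
  qed
qed

lemma thompson_map_add_caret:
  assumes "leaves Tp = leaves Tm" "k < leaves Tm"
  shows "thompson_map (add_caret k Tp) (add_caret k Tm) = thompson_map Tp Tm"
proof
  fix x :: real
  show "thompson_map (add_caret k Tp) (add_caret k Tm) x = thompson_map Tp Tm x"
  proof (cases "x \<in> {0..1}")
    case True
    then obtain y where y: "y \<in> {0..real (leaves (add_caret k Tm))}" "x = leaf_param (add_caret k Tm) y"
      by (rule leaf_param_surj_01)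
    have "real k + 1 \<le> leaves Tm" using assms(2) by linarith
    then have "squeeze k y \<in> {0..real (leaves Tm)}" using y(1) by (simp add: squeeze_def field_simps)
    then show ?thesis
      using assms y leaf_param_add_caret[of k Tm y] leaf_param_add_caret[of k Tp y]
        thompson_map_leaf_param[of "add_caret k Tp" "add_caret k Tm" y]
        thompson_map_leaf_param[of Tp Tm "squeeze k y"]
      by simp
  next
    case False
    then show ?thesis by (simp add: thompson_map_undefined[OF False])
  qed
qed

text \<open>Carets are added one at a time, so that invariance under a single pair of opposite
  carets carries over to refinements by induction.\<close>

inductive refines :: "btree \<Rightarrow> btree \<Rightarrow> bool" where
  refines_refl: "refines T T"
| refines_step: "refines U T \<Longrightarrow> k < leaves U \<Longrightarrow> refines (add_caret k U) T"

lemma refines_trans: "refines V U \<Longrightarrow> refines U T \<Longrightarrow> refines V T"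
  by (induction rule: refines.induct) (auto intro: refines.intros)

lemma refines_left: "refines U T \<Longrightarrow> refines (Node U r) (Node T r)"
proof (induction rule: refines.induct)
  case (refines_step U T k)
  then show ?case using refines.refines_step[of "Node U r" "Node T r" k] by simp
qed (rule refines_refl)

lemma refines_right: "refines U T \<Longrightarrow> refines (Node l U) (Node l T)"
proof (induction rule: refines.induct)
  case (refines_step U T k)
  then show ?case using refines.refines_step[of "Node l U" "Node l T" "leaves l + k"] by simp
qed (rule refines_refl)

lemma refines_Node: "refines U T \<Longrightarrow> refines V S \<Longrightarrow> refines (Node U V) (Node T S)"
  using refines_left refines_right refines_trans by blast

lemma refines_Leaf: "refines T Leaf"
proof (induction T)
  case (Node l r)
  have "refines (Node Leaf Leaf) Leaf"
    using refines_step[OF refines_refl, of 0 Leaf] by simp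
  with Node show ?case using refines_Node refines_trans by blast
qed (rule refines_refl)

text \<open>The induction superposes the trees; where one of them ends in a leaf, the other one
  refines it.\<close>

lemma common_refinement: "\<exists>U. refines U S \<and> refines U T"
proof (induction S arbitrary: T)
  case Leaf
  then show ?case using refines_Leaf refines_refl by blast
next
  case (Node l r)
  then show ?case
    by (cases T) (blast intro: refines_Leaf refines_refl refines_Node)+
qed

section \<open>Components of arc systems\<close>

text \<open>The equivalence relation generated on the whole type. On the field it has the same
  classes as the relation in \<open>circles\<close>, but reflexivity carries no side
  condition.\<close>

definition joined :: "('a \<times> 'a) set \<Rightarrow> ('a \<times> 'a) set" where
  "joined R = (R \<union> R\<inverse>)\<^sup>*"

lemma joined_refl [simp]: "(x, x) \<in> joined R"
  by (simp add: joined_def)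

lemma joined_sym: "(x, y) \<in> joined R \<Longrightarrow> (y, x) \<in> joined R"
  unfolding joined_def by (metis symD sym_rtrancl sym_Un_converse)

lemma joined_trans: "(x, y) \<in> joined R \<Longrightarrow> (y, z) \<in> joined R \<Longrightarrow> (x, z) \<in> joined R"
  unfolding joined_def by (rule rtrancl_trans)

lemma joined_base: "(x, y) \<in> R \<Longrightarrow> (x, y) \<in> joined R"
  unfolding joined_def by auto

lemma joined_invariant:
  assumes "(x, y) \<in> joined R" "\<And>x y. (x, y) \<in> R \<Longrightarrow> f x = f y"
  shows "f x = f y"
  using assms(1) unfolding joined_def by (induction rule: rtrancl_induct) (auto dest: assms(2))

lemma joined_least: "R \<subseteq> joined R' \<Longrightarrow> joined R \<subseteq> joined R'"
proof -
  assume "R \<subseteq> joined R'"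
  then have "R \<union> R\<inverse> \<subseteq> joined R'" by (auto intro: joined_sym)
  then have "joined R \<subseteq> (joined R')\<^sup>*" unfolding joined_def by (rule rtrancl_mono)
  then show ?thesis by (simp add: joined_def)
qed

lemma joined_mono: "R \<subseteq> R' \<Longrightarrow> joined R \<subseteq> joined R'"
  by (rule joined_least) (auto intro: joined_base)

lemma joined_Field: "(x, y) \<in> joined R \<Longrightarrow> x \<in> Field R \<longleftrightarrow> y \<in> Field R"
  by (erule joined_invariant) (auto simp: Field_def)

text \<open>A path can be shortened so that it uses the new arc at most once, in one of its two
  directions.\<close>

lemma joined_insert_iff:
  "(x, y) \<in> joined (insert (a, b) R) \<longleftrightarrow> (x, y) \<in> joined R \<or>
     (x, a) \<in> joined R \<and> (b, y) \<in> joined R \<or> (x, b) \<in> joined R \<and> (a, y) \<in> joined R"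
proof
  assume "(x, y) \<in> joined (insert (a, b) R)"
  then show "(x, y) \<in> joined R \<or>
     (x, a) \<in> joined R \<and> (b, y) \<in> joined R \<or> (x, b) \<in> joined R \<and> (a, y) \<in> joined R"
    unfolding joined_def[of "insert (a, b) R"]
  proof (induction rule: rtrancl_induct)
    case (step y z)
    consider "(y, z) \<in> joined R" | "y = a" "z = b" | "y = b" "z = a"
      using step.hyps(2) by (auto intro: joined_base joined_sym[OF joined_base])
    then show ?case
    proof cases
      case 1
      then show ?thesis using step.IH joined_trans[OF _ 1] by blast
    qed (use step.IH joined_sym joined_trans joined_refl in metis)+
  qed simp
next
  let ?R = "insert (a, b) R"
  have R: "u \<in> joined ?R" if "u \<in> joined R" for u
    using that joined_mono[of R ?R] by blast
  have ab: "(a, b) \<in> joined ?R" by (rule joined_base) simp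
  assume "(x, y) \<in> joined R \<or>
     (x, a) \<in> joined R \<and> (b, y) \<in> joined R \<or> (x, b) \<in> joined R \<and> (a, y) \<in> joined R"
  then show "(x, y) \<in> joined ?R"
    using R[of "(x, y)"] joined_trans[OF R joined_trans[OF ab R]]
      joined_trans[OF R joined_trans[OF joined_sym[OF ab] R]]
    by blast
qed

lemma joined_class_eq_iff: "joined R `` {x} = joined R `` {y} \<longleftrightarrow> (x, y) \<in> joined R"
proof
  assume eq: "joined R `` {x} = joined R `` {y}"
  have "y \<in> joined R `` {y}" by simp
  then show "(x, y) \<in> joined R" unfolding eq[symmetric] by simp
next
  assume xy: "(x, y) \<in> joined R"
  have "(x, z) \<in> joined R \<longleftrightarrow> (y, z) \<in> joined R" for z
    using joined_trans[OF xy] joined_trans[OF joined_sym[OF xy]] by blast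
  then show "joined R `` {x} = joined R `` {y}" by auto
qed

section \<open>Counting components\<close>

lemma circles_eq: "circles R = card ((\<lambda>x. joined R `` {x}) ` Field R)"
proof -
  have "(joined R \<inter> Field R \<times> Field R) `` {x} = joined R `` {x}" if "x \<in> Field R" for x
    using that joined_Field by fastforce
  then have "Field R // (joined R \<inter> Field R \<times> Field R) = (\<lambda>x. joined R `` {x}) ` Field R"
    by (auto simp: quotient_def)
  then show ?thesis by (simp add: circles_def joined_def)
qed

lemma circles_cong: "Field R = Field R' \<Longrightarrow> joined R = joined R' \<Longrightarrow> circles R = circles R'"
  by (simp add: circles_eq)

lemma circles_cong_sym:
  assumes "R \<union> R\<inverse> = R' \<union> R'\<inverse>"
  shows "circles R = circles R'"
proof (rule circles_cong)
  have "Field S = Field (S \<union> S\<inverse>)" for S :: "('a \<times> 'a) set" by (auto simp: Field_def)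
  then show "Field R = Field R'" by (metis assms)
  show "joined R = joined R'" unfolding joined_def assms ..
qed

lemma Field_insert_inside: "a \<in> Field R \<Longrightarrow> b \<in> Field R \<Longrightarrow> Field (insert (a, b) R) = Field R"
  by auto

lemma circles_insert_joined:
  assumes "(a, b) \<in> joined R" "a \<in> Field R" "b \<in> Field R"
  shows "circles (insert (a, b) R) = circles R"
proof (rule circles_cong)
  show "joined (insert (a, b) R) = joined R"
    by (rule antisym; rule joined_least) (use assms(1) in \<open>auto intro: joined_base\<close>)
qed (rule Field_insert_inside; fact)

text \<open>The classes of \<open>a\<close> and \<open>b\<close> merge and all other classes
  survive, so two classes are replaced by one.\<close>

lemma circles_insert_unjoined:
  assumes "finite R" "(a, b) \<notin> joined R" "a \<in> Field R" "b \<in> Field R"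
  shows "Suc (circles (insert (a, b) R)) = circles R"
proof -
  define c where "c x = joined R `` {x}" for x
  define c' where "c' x = joined (insert (a, b) R) `` {x}" for x
  define F where "F = Field R"
  have ab: "a \<in> F" "b \<in> F" using assms by (simp_all add: F_def)
  have mem: "y \<in> c x \<longleftrightarrow> (x, y) \<in> joined R" for x y by (simp add: c_def)
  have eq: "c x = c y \<longleftrightarrow> (x, y) \<in> joined R" for x y
    unfolding c_def by (rule joined_class_eq_iff)
  have new: "c' x = (if x \<in> c a \<union> c b then c a \<union> c b else c x)" for x
  proof (rule Set.set_eqI)
    fix y
    have "(x, y) \<in> joined R \<Longrightarrow> (a, x) \<in> joined R \<Longrightarrow> (a, y) \<in> joined R"
      "(x, y) \<in> joined R \<Longrightarrow> (b, x) \<in> joined R \<Longrightarrow> (b, y) \<in> joined R"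
      "(a, x) \<in> joined R \<Longrightarrow> (a, y) \<in> joined R \<Longrightarrow> (x, y) \<in> joined R"
      "(b, x) \<in> joined R \<Longrightarrow> (b, y) \<in> joined R \<Longrightarrow> (x, y) \<in> joined R"
      "(x, a) \<in> joined R \<longleftrightarrow> (a, x) \<in> joined R" "(x, b) \<in> joined R \<longleftrightarrow> (b, x) \<in> joined R"
      using joined_trans joined_sym by metis+
    then show "y \<in> c' x \<longleftrightarrow> y \<in> (if x \<in> c a \<union> c b then c a \<union> c b else c x)"
      by (auto simp: joined_insert_iff c_def c'_def)
  qed
  have old: "x \<in> c a \<union> c b \<longleftrightarrow> c x = c a \<or> c x = c b" for x
    unfolding Un_iff mem eq[symmetric] by metis
  have "c' ` F = insert (c a \<union> c b) (c ` {x \<in> F. x \<notin> c a \<union> c b})"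
  proof (rule Set.set_eqI)
    fix C
    have "a \<in> c a" by (simp add: mem)
    then show "C \<in> c' ` F \<longleftrightarrow> C \<in> insert (c a \<union> c b) (c ` {x \<in> F. x \<notin> c a \<union> c b})"
      using ab(1) by (auto simp: image_iff new)
  qed
  also have "c ` {x \<in> F. x \<notin> c a \<union> c b} = c ` F - {c a, c b}"
    unfolding old by auto
  finally have "circles (insert (a, b) R) = card (insert (c a \<union> c b) (c ` F - {c a, c b}))"
    unfolding circles_eq Field_insert_inside[OF assms(3,4)] by (simp add: c'_def F_def)
  \<comment> \<open>An old class that contains \<open>a\<close> is the class of \<open>a\<close>, so
    the merged class is not among the survivors.\<close>
  moreover have "c a \<union> c b \<notin> c ` F - {c a, c b}"
  proof
    assume "c a \<union> c b \<in> c ` F - {c a, c b}"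
    then obtain x where x: "c x = c a \<union> c b" "c x \<noteq> c a" by auto
    then have "a \<in> c x" by (simp add: mem)
    then show False using x(2) by (simp add: mem eq)
  qed
  moreover have fin: "finite (c ` F)" using assms(1) by (simp add: finite_Field F_def)
  moreover have "c a \<noteq> c b" using assms(2) by (simp add: eq)
  then have "card {c a, c b} = 2" by simp
  moreover have "{c a, c b} \<subseteq> c ` F" using ab by simp
  moreover from this fin have "card {c a, c b} \<le> card (c ` F)" by (intro card_mono)
  ultimately show ?thesis
    by (simp add: circles_eq card_Diff_subset c_def F_def)
qed

lemma circles_insert_bounds:
  assumes "finite R" "a \<in> Field R" "b \<in> Field R"
  shows "circles (insert (a, b) R) \<le> circles R" "circles R \<le> Suc (circles (insert (a, b) R))"
  using circles_insert_joined[of a b R] circles_insert_unjoined[of R a b] assms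
  by (cases "(a, b) \<in> joined R"; simp)+

text \<open>Such an \<open>f\<close> factors through the set of components. It will be the face next
  to a strand.\<close>

lemma card_image_le_circles:
  assumes "finite R" "\<And>x y. (x, y) \<in> R \<Longrightarrow> f x = f y"
  shows "card (f ` Field R) \<le> circles R"
proof -
  have "f x = f y" if "(x, y) \<in> joined R" for x y
    using that by (rule joined_invariant) (rule assms(2))
  then have "f ` joined R `` {x} = {f x}" for x by fastforce
  then have "f ` Field R = (\<lambda>C. the_elem (f ` C)) ` (\<lambda>x. joined R `` {x}) ` Field R"
    by (simp add: image_image)
  then show ?thesis
    unfolding circles_eq by (metis assms(1) card_image_le finite_Field finite_imageI)
qed

text \<open>Every component contains a representative \<open>g v\<close> with \<open>v\<close> a
  value of \<open>f\<close>. Here \<open>f\<close> will be the vertex next to a strand, or a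
  constant.\<close>

lemma circles_le_card_image:
  assumes "finite R" "\<And>x. x \<in> Field R \<Longrightarrow> (x, g (f x)) \<in> joined R"
  shows "circles R \<le> card (f ` Field R)"
proof -
  have "(\<lambda>x. joined R `` {x}) ` Field R = (\<lambda>v. joined R `` {g v}) ` f ` Field R"
    unfolding image_image
    by (rule image_cong) (use assms(2) in \<open>auto simp: joined_class_eq_iff\<close>)
  then show ?thesis
    unfolding circles_eq by (metis assms(1) card_image_le finite_Field finite_imageI)
qed

text \<open>Functions constant along \<open>R\<close> are the functions on the set of components,
  composed with the class map by \<open>?lift\<close>.\<close>

lemma card_invariant_functions:
  assumes "finite R"
  shows "card {\<sigma> \<in> Field R \<rightarrow>\<^sub>E B. \<forall>(x, y)\<in>R. \<sigma> x = \<sigma> y} = card B ^ circles R" (is "card ?I = _")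
proof -
  let ?c = "\<lambda>x. joined R `` {x}" and ?F = "Field R"
  let ?lift = "\<lambda>h. \<lambda>x\<in>?F. h (?c x)"
  have "bij_betw ?lift (?c ` ?F \<rightarrow>\<^sub>E B) ?I"
  proof (rule bij_betw_imageI)
    show "inj_on ?lift (?c ` ?F \<rightarrow>\<^sub>E B)"
    proof (rule inj_onI)
      fix h h' assume h: "h \<in> ?c ` ?F \<rightarrow>\<^sub>E B" "h' \<in> ?c ` ?F \<rightarrow>\<^sub>E B" and eq: "?lift h = ?lift h'"
      from h show "h = h'"
      proof (rule PiE_ext)
        fix C assume "C \<in> ?c ` ?F"
        then obtain x where "x \<in> ?F" "C = ?c x" by blast
        with fun_cong[OF eq, of x] show "h C = h' C" by simp
      qed
    qed
    show "?lift ` (?c ` ?F \<rightarrow>\<^sub>E B) = ?I"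
    proof
      have "?c x = ?c y" if "(x, y) \<in> R" for x y
        using that by (simp add: joined_class_eq_iff joined_base)
      then show "?lift ` (?c ` ?F \<rightarrow>\<^sub>E B) \<subseteq> ?I"
        by (auto simp: PiE_iff FieldI1 FieldI2)
      show "?I \<subseteq> ?lift ` (?c ` ?F \<rightarrow>\<^sub>E B)"
      proof
        fix \<sigma> assume \<sigma>: "\<sigma> \<in> ?I"
        have "\<sigma> x = \<sigma> y" if "(x, y) \<in> joined R" for x y
          using that by (rule joined_invariant) (use \<sigma> in auto)
        then have const: "\<sigma> ` ?c x = {\<sigma> x}" for x by fastforce
        \<comment> \<open>The inverse of \<open>?lift\<close>: \<open>\<sigma>\<close> takes a
          single value on each class, which \<open>the_elem\<close> extracts.\<close>
        let ?h = "\<lambda>C\<in>?c ` ?F. the_elem (\<sigma> ` C)"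
        from \<sigma> have PiE: "\<sigma> \<in> ?F \<rightarrow>\<^sub>E B" by simp
        then have "?h \<in> ?c ` ?F \<rightarrow>\<^sub>E B"
          unfolding restrict_PiE_iff ball_simps const the_elem_eq by (blast dest: PiE_mem)
        moreover have "\<sigma> = ?lift ?h"
        proof
          show "\<sigma> x = ?lift ?h x" for x
            by (cases "x \<in> ?F") (simp_all add: const PiE_arb[OF PiE])
        qed
        ultimately show "\<sigma> \<in> ?lift ` (?c ` ?F \<rightarrow>\<^sub>E B)" by blast
      qed
    qed
  qed
  then have "card ?I = card (?c ` ?F \<rightarrow>\<^sub>E B)" by (simp add: bij_betw_same_card)
  also have "\<dots> = card B ^ circles R" by (simp add: card_funcsetE circles_eq finite_Field assms)
  finally show ?thesis .
qed

text \<open>The two smoothings \<open>pq, rs\<close> and \<open>pr, qs\<close> of a crossing become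
  equivalent after one more arc: either way all four ends are joined.\<close>

lemma joined_four:
  "joined (insert (p, r) (insert (p, q) (insert (r, s) R))) =
   joined (insert (p, q) (insert (p, r) (insert (q, s) R)))" (is "joined ?R1 = joined ?R2")
proof (rule antisym; rule joined_least)
  have mem: "(p, q) \<in> joined ?R1" "(p, r) \<in> joined ?R1" "(r, s) \<in> joined ?R1"
    "(p, q) \<in> joined ?R2" "(p, r) \<in> joined ?R2" "(q, s) \<in> joined ?R2"
    by (simp_all add: joined_base)
  have "(q, s) \<in> joined ?R1"
    by (rule joined_trans[OF joined_sym[OF mem(1)] joined_trans[OF mem(2) mem(3)]])
  moreover have "R \<subseteq> joined ?R1" by (simp add: joined_base subset_iff)
  ultimately show "?R2 \<subseteq> joined ?R1" using mem by simp
  have "(r, s) \<in> joined ?R2"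
    by (rule joined_trans[OF joined_sym[OF mem(5)] joined_trans[OF mem(4) mem(6)]])
  moreover have "R \<subseteq> joined ?R2" by (simp add: joined_base subset_iff)
  ultimately show "?R1 \<subseteq> joined ?R2" using mem by simp
qed

text \<open>Both smoothings are compared with their common extension from
  \<open>joined_four\<close>: removing an arc from it creates at most one component, and adding an
  arc to the old smoothing creates none.\<close>

lemma circles_smoothing_le:
  assumes "finite R" "{p, q, r, s} \<subseteq> Field R"
  shows "circles (insert (p, r) (insert (q, s) R)) \<le> Suc (circles (insert (p, q) (insert (r, s) R)))"
proof -
  let ?old = "insert (p, q) (insert (r, s) R)" and ?new = "insert (p, r) (insert (q, s) R)"
  have F: "Field ?old = Field R" "Field ?new = Field R" using assms(2) by auto
  have "circles ?new \<le> Suc (circles (insert (p, q) ?new))"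
    by (rule circles_insert_bounds) (use assms F in auto)
  also have "circles (insert (p, q) ?new) = circles (insert (p, r) ?old)"
    by (rule circles_cong[OF _ joined_four[symmetric]]) (use assms F in auto)
  also have "\<dots> \<le> circles ?old"
    by (rule circles_insert_bounds) (use assms F in auto)
  finally show ?thesis by simp
qed

text \<open>If \<open>p\<close> and \<open>q\<close> are already joined away from the crossing, the
  new smoothing has as many components as the common extension, whereas the old one has two
  components that merge there.\<close>

lemma circles_smoothing_less:
  assumes "finite R" "{p, q, r, s} \<subseteq> Field R" "(p, q) \<in> joined R"
    "(p, r) \<notin> joined (insert (p, q) (insert (r, s) R))"
  shows "Suc (circles (insert (p, r) (insert (q, s) R))) = circles (insert (p, q) (insert (r, s) R))"
proof -
  let ?old = "insert (p, q) (insert (r, s) R)" and ?new = "insert (p, r) (insert (q, s) R)"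
  have F: "Field ?old = Field R" "Field ?new = Field R" using assms(2) by auto
  have "(p, q) \<in> joined ?new" using assms(3) joined_mono[of R ?new] by blast
  then have "circles ?new = circles (insert (p, q) ?new)"
    by (subst circles_insert_joined) (use assms F in auto)
  also have "\<dots> = circles (insert (p, r) ?old)"
    by (rule circles_cong[OF _ joined_four[symmetric]]) (use assms F in auto)
  finally show ?thesis
    using circles_insert_unjoined[of ?old p r] assms F by auto
qed

section \<open>Arches of a tree\<close>

lemma arches_bounds: "(a, b) \<in> set (arches k T) \<Longrightarrow> k \<le> a \<and> a < b \<and> b < k + leaves T"
proof (induction T arbitrary: k)
  case (Node l r)
  from Node.prems consider "a = k" "b = k + leaves l" | "(a, b) \<in> set (arches k l)"
    | "(a, b) \<in> set (arches (k + leaves l) r)" by auto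
  then show ?case using Node.IH leaves_pos[of l] leaves_pos[of r] by cases fastforce+
qed simp

lemma distinct_arches: "distinct (arches k T)"
proof (induction T arbitrary: k)
  case (Node l r)
  then show ?case
    using arches_bounds[of k _ k l] arches_bounds[of _ _ "k + leaves l" r] arches_bounds[of _ _ k l]
    by fastforce
qed simp

lemma length_arches: "Suc (length (arches k T)) = leaves T"
proof (induction T arbitrary: k)
  case (Node l r)
  then show ?case by (metis arches.simps(2) add_Suc add_Suc_right leaves.simps(2) length_Cons length_append)
qed simp

lemma arches_connected: "k \<le> v \<Longrightarrow> v < k + leaves T \<Longrightarrow> (k, v) \<in> joined (set (arches k T))"
proof (induction T arbitrary: k v)
  case (Node l r)
  let ?m = "k + leaves l"
  have sub: "set (arches k l) \<subseteq> set (arches k (Node l r))"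
    "set (arches ?m r) \<subseteq> set (arches k (Node l r))" by auto
  show ?case
  proof (cases "v < ?m")
    case True
    then show ?thesis using Node.IH(1)[of k v] Node.prems joined_mono[OF sub(1)] by blast
  next
    case False
    then have "(?m, v) \<in> joined (set (arches k (Node l r)))"
      using Node.IH(2)[of ?m v] Node.prems joined_mono[OF sub(2)] by auto
    moreover have "(k, ?m) \<in> joined (set (arches k (Node l r)))" by (rule joined_base) simp
    ultimately show ?thesis by (rule joined_trans[rotated])
  qed
qed (simp add: le_less_Suc_eq)

text \<open>
  The face directly below an arch \<open>(a, b)\<close> is the one that meets the \<open>x\<close>-axis between \<open>b - 1\<close>
  and \<open>b\<close>; the face directly above it meets the axis between \<open>c - 1\<close> and \<open>c\<close>, where
  \<open>c = outer k T b\<close> is the number of the last leaf below the caret of the arch.  The value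
  \<open>k + leaves T\<close> stands for the unbounded face.
\<close>

fun outer :: "nat \<Rightarrow> btree \<Rightarrow> nat \<Rightarrow> nat" where
  "outer k Leaf v = k + 1"
| "outer k (Node l r) v =
     (if v = k then k + leaves (Node l r)
      else if v < k + leaves l then outer k l v else outer (k + leaves l) r v)"

lemma outer_first [simp]: "outer k T k = k + leaves T"
  by (cases T) auto

lemma outer_bounds: "k \<le> v \<Longrightarrow> v < k + leaves T \<Longrightarrow> v < outer k T v \<and> outer k T v \<le> k + leaves T"
proof (induction T arbitrary: k v)
  case (Node l r)
  show ?case using Node.IH(1)[of k v] Node.IH(2)[of "k + leaves l" v] Node.prems by auto
qed simp

text \<open>The right neighbours by recursion on the tree, innermost arch first: the root arch
  encloses all arches of the left subtree that start at \<open>k\<close>, hence comes last.\<close>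

fun rights :: "nat \<Rightarrow> btree \<Rightarrow> nat \<Rightarrow> nat list" where
  "rights k Leaf v = []"
| "rights k (Node l r) v =
     (if v = k then rights k l k @ [k + leaves l]
      else if v < k + leaves l then rights k l v else rights (k + leaves l) r v)"

lemma set_rights:
  "k \<le> v \<Longrightarrow> v < k + leaves T \<Longrightarrow> set (rights k T v) = {b. (v, b) \<in> set (arches k T)}"
proof (induction T arbitrary: k v)
  case (Node l r)
  have "(v, b) \<notin> set (arches (k + leaves l) r)" if "v < k + leaves l" for b
    using that arches_bounds[of v b "k + leaves l" r] by auto
  moreover have "(v, b) \<notin> set (arches k l)" if "\<not> v < k + leaves l" for b
    using that arches_bounds[of v b k l] by auto
  ultimately show ?case
    using Node.IH(1)[of k v] Node.IH(2)[of "k + leaves l" v] Node.prems leaves_pos[of l]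
    by (auto simp del: leaves_pos)
qed simp

lemma rights_bounds:
  "b \<in> set (rights k T v) \<Longrightarrow> k \<le> v \<Longrightarrow> v < k + leaves T \<Longrightarrow> v < b \<and> b < k + leaves T"
  using set_rights[of k v T] arches_bounds[of v b k T] by auto

lemma sorted_rights: "k \<le> v \<Longrightarrow> v < k + leaves T \<Longrightarrow> sorted_wrt (<) (rights k T v)"
proof (induction T arbitrary: k v)
  case (Node l r)
  then show ?case
    using Node.IH(1)[of k v] Node.IH(2)[of "k + leaves l" v] rights_bounds[of _ k l k]
    by (auto simp: sorted_wrt_append)
qed simp

text \<open>The root arch is the only one ending at \<open>?m\<close>; every other vertex after
  \<open>k\<close> is settled in the subtree that contains it.\<close>

lemma left_neighbour:
  "k < v \<Longrightarrow> v < k + leaves T \<Longrightarrow> \<exists>a. {a. (a, v) \<in> set (arches k T)} = {a}"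
proof (induction T arbitrary: k v)
  case (Node l r)
  let ?m = "k + leaves l"
  have l: "(a, v) \<notin> set (arches k l)" if "?m \<le> v" for a
    using that arches_bounds[of a v k l] by auto
  have r: "(a, v) \<notin> set (arches ?m r)" if "v \<le> ?m" for a
    using that arches_bounds[of a v ?m r] by auto
  consider "v < ?m" | "v = ?m" | "?m < v" by linarith
  then show ?case
  proof cases
    case 1
    then have "{a. (a, v) \<in> set (arches k (Node l r))} = {a. (a, v) \<in> set (arches k l)}"
      using r by auto
    then show ?thesis using Node.IH(1)[of k v] Node.prems 1 by simp
  next
    case 2
    then have "{a. (a, v) \<in> set (arches k (Node l r))} = {k}"
      using l r by auto
    then show ?thesis by blast
  next
    case 3
    then have "{a. (a, v) \<in> set (arches k (Node l r))} = {a. (a, v) \<in> set (arches ?m r)}"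
      using l by auto
    then show ?thesis using Node.IH(2)[of ?m v] Node.prems 3 by simp
  qed
qed simp

text \<open>Around \<open>v\<close>, the face above each arch to the right is the face below the next one.\<close>

fun stacked :: "(nat \<Rightarrow> nat) \<Rightarrow> nat \<Rightarrow> nat list \<Rightarrow> nat \<Rightarrow> bool" where
  "stacked up x [] y \<longleftrightarrow> x = y"
| "stacked up x (b # bs) y \<longleftrightarrow> x = b \<and> stacked up (up b) bs y"

lemma stacked_snoc: "stacked up x (bs @ [b]) y \<longleftrightarrow> stacked up x bs b \<and> y = up b"
  by (induction bs arbitrary: x) auto

lemma stacked_cong:
  "stacked up x bs y \<Longrightarrow> (\<And>b. b \<in> set bs \<Longrightarrow> up b = up' b) \<Longrightarrow> stacked up' x bs y"
  by (induction bs arbitrary: x) auto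

lemma stacked_rights:
  "k \<le> v \<Longrightarrow> v < k + leaves T \<Longrightarrow> stacked (outer k T) (Suc v) (rights k T v) (outer k T v)"
proof (induction T arbitrary: k v)
  case (Node l r)
  let ?m = "k + leaves l"
  show ?case
  proof (cases "v < ?m")
    case True
    have "stacked (outer k (Node l r)) (Suc v) (rights k l v) (outer k l v)"
    proof (rule stacked_cong[OF Node.IH(1)])
      fix b assume "b \<in> set (rights k l v)"
      then have "v < b" "b < ?m" using rights_bounds[of b k l v] Node.prems True by auto
      then show "outer k l b = outer k (Node l r) b" using Node.prems by auto
    qed (use Node.prems True in auto)
    \<comment> \<open>The root arch ends at \<open>?m\<close>, and the face above it is the
      unbounded one; the face below it is \<open>outer k l k\<close>, so it can be stacked on the
      arches of \<open>l\<close>.\<close>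
    moreover have "outer k (Node l r) ?m = outer k (Node l r) k"
      using leaves_pos[of l] by (simp del: leaves_pos)
    moreover have "outer k (Node l r) v = outer k l v" if "v \<noteq> k"
      using that True by simp
    ultimately show ?thesis
      using True by (cases "v = k") (simp_all add: stacked_snoc del: outer.simps)
  next
    case False
    have "stacked (outer k (Node l r)) (Suc v) (rights ?m r v) (outer ?m r v)"
    proof (rule stacked_cong[OF Node.IH(2)])
      fix b assume "b \<in> set (rights ?m r v)"
      then have "v < b" using rights_bounds[of b ?m r v] Node.prems False by auto
      then show "outer ?m r b = outer k (Node l r) b" using Node.prems False by auto
    qed (use Node.prems False in auto)
    moreover have "v \<noteq> k" using False leaves_pos[of l] by auto
    moreover from this have "outer k (Node l r) v = outer ?m r v" using False by simp
    ultimately show ?thesis using False by (simp del: outer.simps)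
  qed
qed simp


section \<open>States of the link diagram\<close>

text \<open>This smoothing cuts the edge: each arc turns back at one end of it. The arcs of a
  contraction instead run along its two sides.\<close>

definition deletion_arcs :: "edge \<Rightarrow> (label \<times> label) set" where
  "deletion_arcs e = {(Strand e NW, Strand e SW), (Strand e NE, Strand e SE)}"

definition contraction_arcs :: "edge \<Rightarrow> (label \<times> label) set" where
  "contraction_arcs e = {(Strand e NW, Strand e NE), (Strand e SW, Strand e SE)}"

definition state_arcs :: "edge set \<Rightarrow> edge set \<Rightarrow> (label \<times> label) set" where
  "state_arcs E S = (\<Union>e\<in>E. if e \<in> S then contraction_arcs e else deletion_arcs e)"

fun end_vertex :: "label \<Rightarrow> nat" where
  "end_vertex (Strand (s, a, b) d) = (if d \<in> {NW, SW} then a else b)"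
| "end_vertex (Loop v) = v"

text \<open>The loops \<open>Id_on\<close> put isolated vertices into the field, so that
  \<open>circles\<close> counts them as components.\<close>

definition graph :: "nat \<Rightarrow> edge set \<Rightarrow> (nat \<times> nat) set" where
  "graph n S = Id_on {..<n} \<union> snd ` S"

locale tree_pair =
  fixes Tp Tm :: btree and n :: nat and E :: "edge list"
  assumes leaves_eq: "leaves Tp = n" "leaves Tm = n"
    and E_eq: "E = signed_graph Tp Tm"
begin

section \<open>The rotation system and the corner arcs\<close>

lemma edge_bounds: "(s, a, b) \<in> set E \<Longrightarrow> a < b \<and> b < n"
  using arches_bounds[of a b 0 Tp] arches_bounds[of a b 0 Tm] leaves_eq
  by (auto simp: E_eq signed_graph_def)

lemma distinct_E: "distinct E"
  by (auto simp: E_eq signed_graph_def distinct_map distinct_arches inj_on_def)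

lemma length_E: "length E + 2 = 2 * n"
  using length_arches[of 0 Tp] length_arches[of 0 Tm] leaves_eq
  by (simp add: E_eq signed_graph_def)

lemma n_pos: "0 < n"
  using leaves_pos[of Tp] leaves_eq by simp

lemma set_rotation:
  "set (rotation E v) =
     {LeftEnd (s, v, b) |s b. (s, v, b) \<in> set E} \<union> {RightEnd (s, a, v) |s a. (s, a, v) \<in> set E}"
proof -
  have "finite {b. (s, v, b) \<in> set E}" "finite {a. (s, a, v) \<in> set E}" for s
    by (rule finite_subset[of _ "(snd \<circ> snd) ` set E"]; force)
      (rule finite_subset[of _ "(fst \<circ> snd) ` set E"]; force)
  then have "set (right_neighbours E s v) = {b. (s, v, b) \<in> set E}"
    "set (left_neighbours E s v) = {a. (s, a, v) \<in> set E}" for s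
    by (simp_all add: right_neighbours_def left_neighbours_def)
  then show ?thesis
    unfolding rotation_def by (auto simp: image_iff) (metis sign.exhaust)+
qed

lemma distinct_rotation: "distinct (rotation E v)"
  by (auto simp: rotation_def right_neighbours_def left_neighbours_def distinct_map inj_on_def)

lemma nth_corner_arcs:
  assumes "i < length (rotation E v)"
  shows "(ccw_side (rotation E v ! i),
      cw_side (rotation E v ! (Suc i mod length (rotation E v)))) \<in> set (corner_arcs E v)"
proof -
  let ?r = "rotation E v"
  have "zip ?r (rotate1 ?r) ! i = (?r ! i, ?r ! (Suc i mod length ?r))"
    using assms by (simp add: nth_rotate1)
  then have "(?r ! i, ?r ! (Suc i mod length ?r)) \<in> set (zip ?r (rotate1 ?r))"
    using assms by (metis length_zip length_rotate1 min.idem nth_mem)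
  moreover have "?r \<noteq> []" using assms by auto
  ultimately show ?thesis by (force simp: corner_arcs_def)
qed

lemma corner_arcsE:
  assumes "(x, y) \<in> set (corner_arcs E v)"
  obtains "rotation E v = []" "x = Loop v" "y = Loop v"
  | d d' where "(d, d') \<in> set (zip (rotation E v) (rotate1 (rotation E v)))"
      "x = ccw_side d" "y = cw_side d'"
  using assms by (auto simp: corner_arcs_def split: if_splits)

lemma end_vertex_side:
  assumes "d \<in> set (rotation E v)"
  shows "end_vertex (ccw_side d) = v" "end_vertex (cw_side d) = v"
  using assms by (auto simp: set_rotation)

lemma corner_arcs_end_vertex:
  assumes "(x, y) \<in> set (corner_arcs E v)"
  shows "end_vertex x = v" "end_vertex y = v"
proof -
  have "end_vertex x = v \<and> end_vertex y = v"
    using assms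
  proof (cases rule: corner_arcsE)
    case (2 d d')
    then have "d \<in> set (rotation E v)" "d' \<in> set (rotation E v)"
      using set_zip_leftD[OF 2(1)] set_zip_rightD[OF 2(1)] by simp_all
    then show ?thesis using 2 by (simp add: end_vertex_side)
  qed simp
  then show "end_vertex x = v" "end_vertex y = v" by simp_all
qed

definition corners :: "(label \<times> label) set" where
  "corners = (\<Union>v<n. set (corner_arcs E v))"

definition arcs :: "edge set \<Rightarrow> (label \<times> label) set" where
  "arcs S = corners \<union> state_arcs (set E) S"

lemma finite_corners: "finite corners"
  by (simp add: corners_def)

lemma finite_state_arcs: "finite F \<Longrightarrow> finite (state_arcs F S)"
  by (simp add: state_arcs_def contraction_arcs_def deletion_arcs_def)

lemma finite_arcs: "finite (arcs S)"
  by (simp add: arcs_def finite_corners finite_state_arcs)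

lemma side_in_corners:
  assumes "d \<in> set (rotation E v)" "v < n"
  shows "ccw_side d \<in> Field corners" "cw_side d \<in> Field corners"
proof -
  let ?r = "rotation E v"
  obtain i where i: "i < length ?r" "d = ?r ! i" using assms(1) by (metis in_set_conv_nth)
  show "ccw_side d \<in> Field corners"
    using nth_corner_arcs[OF i(1)] i(2) assms(2) by (auto simp: corners_def intro: FieldI1)
  \<comment> \<open>The cyclic predecessor of \<open>i\<close>: the clockwise side of an edge end
    lies on the corner arc that starts at the preceding end.\<close>
  define j where "j = (if i = 0 then length ?r - 1 else i - 1)"
  have "j < length ?r" "Suc j mod length ?r = i" using i(1) by (auto simp: j_def)
  then show "cw_side d \<in> Field corners"
    using nth_corner_arcs[of j v] i(2) assms(2) by (auto simp: corners_def intro: FieldI2)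
qed

lemma edge_ends:
  assumes "(s, a, b) \<in> set E"
  shows "LeftEnd (s, a, b) \<in> set (rotation E a)" "RightEnd (s, a, b) \<in> set (rotation E b)"
    "a < n" "b < n"
  using assms edge_bounds[OF assms] by (auto simp: set_rotation)

lemma Strand_in_corners:
  assumes "e \<in> set E"
  shows "Strand e d \<in> Field corners"
proof -
  obtain s a b where e: "e = (s, a, b)" by (cases e)
  note ends = edge_ends[OF assms[unfolded e]]
  show ?thesis
    using side_in_corners[OF ends(1,3)] side_in_corners[OF ends(2,4)] e by (cases d) auto
qed

lemma Field_corners:
  assumes "x \<in> Field corners"
  obtains v where "v < n" "rotation E v = []" "x = Loop v"
  | v d where "v < n" "d \<in> set (rotation E v)" "x \<in> {ccw_side d, cw_side d}"
proof -
  obtain v y where v: "v < n" "(x, y) \<in> set (corner_arcs E v) \<or> (y, x) \<in> set (corner_arcs E v)"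
    using assms by (auto simp: corners_def Field_def)
  then show thesis
    by (metis corner_arcsE insertCI set_rotate1 set_zip_leftD set_zip_rightD that)
qed

lemma Field_arcs: "Field (arcs S) = Field corners"
  using Strand_in_corners
  by (auto simp: arcs_def state_arcs_def contraction_arcs_def deletion_arcs_def Field_Un Field_insert
      Field_def[of "\<Union>_"] split: if_splits)

text \<open>With all edges deleted, corner arcs and deletion arcs alternate around a vertex, so all
  strands next to a vertex \<open>v\<close> are joined to the representative
  \<open>?g v\<close>.\<close>

lemma circles_empty_state: "circles (arcs {}) \<le> n"
proof -
  let ?g = "\<lambda>v. if rotation E v = [] then Loop v else ccw_side (hd (rotation E v))"
  have opp: "(ccw_side d, cw_side d) \<in> joined (arcs {})" if "d \<in> set (rotation E v)" for d v
  proof -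
    from that obtain e where e: "e \<in> set E" "d = LeftEnd e \<or> d = RightEnd e"
      by (auto simp: set_rotation)
    then have "(ccw_side d, cw_side d) \<in> arcs {} \<or> (cw_side d, ccw_side d) \<in> arcs {}"
      by (auto simp: arcs_def state_arcs_def deletion_arcs_def)
    then show ?thesis by (auto intro: joined_base joined_sym)
  qed
  have hd: "(ccw_side (rotation E v ! i), ?g v) \<in> joined (arcs {})"
    if "v < n" "i < length (rotation E v)" for v i
    using that(2)
  proof (induction i)
    case 0
    then show ?case by (simp add: hd_conv_nth)
  next
    case (Suc i)
    let ?d = "rotation E v ! i" and ?d' = "rotation E v ! Suc i"
    have "(ccw_side ?d, cw_side ?d') \<in> arcs {}"
      using nth_corner_arcs[of i v] Suc.prems \<open>v < n\<close> by (auto simp: arcs_def corners_def)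
    then have "(cw_side ?d', ccw_side ?d) \<in> joined (arcs {})"
      by (intro joined_sym[OF joined_base])
    moreover have "(ccw_side ?d', cw_side ?d') \<in> joined (arcs {})"
      using Suc.prems by (intro opp[of _ v]) simp
    ultimately show ?case using Suc by (meson Suc_lessD joined_trans)
  qed
  have "(x, ?g (end_vertex x)) \<in> joined (arcs {})" if x: "x \<in> Field (arcs {})" for x
    using x[unfolded Field_arcs]
  proof (cases rule: Field_corners)
    case (2 v d)
    then obtain i where "i < length (rotation E v)" "d = rotation E v ! i" by (metis in_set_conv_nth)
    then have "(ccw_side d, ?g v) \<in> joined (arcs {})" using hd 2(1) by blast
    moreover have "(x, ccw_side d) \<in> joined (arcs {})"
      using opp[OF 2(2)] 2(3) by (auto intro: joined_sym)
    moreover have "end_vertex x = v" using end_vertex_side[OF 2(2)] 2(3) by auto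
    ultimately show ?thesis by (auto intro: joined_trans)
  qed simp
  then have "circles (arcs {}) \<le> card (end_vertex ` Field (arcs {}))"
    by (intro circles_le_card_image finite_arcs)
  also have "\<dots> \<le> card {..<n}"
  proof (intro card_mono image_subsetI)
    fix x assume "x \<in> Field (arcs {})"
    then have "x \<in> Field corners" by (simp add: Field_arcs)
    then show "end_vertex x \<in> {..<n}"
      by (cases rule: Field_corners) (use end_vertex_side in auto)
  qed simp
  finally show ?thesis by simp
qed

end

lemma Field_graph: "(\<And>s a b. (s, a, b) \<in> S \<Longrightarrow> a < n \<and> b < n) \<Longrightarrow> Field (graph n S) = {..<n}"
  by (fastforce simp: graph_def Field_def)

lemma finite_graph: "finite S \<Longrightarrow> finite (graph n S)"
  unfolding graph_def Id_on_def by auto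

lemma graph_insert: "graph n (insert (s, a, b) S) = insert (a, b) (graph n S)"
  by (auto simp: graph_def)

lemma circles_graph_empty: "circles (graph n {}) = n"
proof -
  have "(x, y) \<in> joined (Id_on {..<n}) \<longleftrightarrow> x = y" for x y
    using joined_invariant[of x y "Id_on {..<n}" id] by auto
  then have "(\<lambda>x. joined (Id_on {..<n}) `` {x}) = (\<lambda>x. {x})" by auto
  moreover have "Field (graph n {}) = {..<n}" by (rule Field_graph) simp
  ultimately show ?thesis
    by (simp add: circles_eq graph_def card_image)
qed

context tree_pair
begin

text \<open>The face containing the strand, named by its gap on the \<open>x\<close>-axis. Reduction
  modulo \<open>n\<close> names the unbounded face 0 in both half planes, which glues their outer
  faces.\<close>

fun face :: "label \<Rightarrow> nat" where
  "face (Strand (Pos, a, b) d) = (if d \<in> {SW, SE} then b else outer 0 Tp b) mod n"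
| "face (Strand (Neg, a, b) d) = (if d \<in> {NW, NE} then b else outer 0 Tm b) mod n"
| "face (Loop v) = 0"

text \<open>A counterclockwise walk around a vertex across consecutive edge ends, from the face
  \<open>x\<close> to the face \<open>y\<close>.\<close>

fun face_walk :: "nat \<Rightarrow> edge_end list \<Rightarrow> nat \<Rightarrow> bool" where
  "face_walk x [] y \<longleftrightarrow> x = y"
| "face_walk x (d # ds) y \<longleftrightarrow> x = face (cw_side d) \<and> face_walk (face (ccw_side d)) ds y"

lemma face_walk_append: "face_walk x ds y \<Longrightarrow> face_walk y ds' z \<Longrightarrow> face_walk x (ds @ ds') z"
  by (induction ds arbitrary: x) auto

lemma face_walk_nth:
  "face_walk x ds y \<Longrightarrow> i < length ds \<Longrightarrow>
     face (ccw_side (ds ! i)) = (if Suc i < length ds then face (cw_side (ds ! Suc i)) else y)"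
proof (induction ds arbitrary: x i)
  case (Cons d ds)
  then show ?case by (cases i; cases ds) auto
qed simp

lemma face_walk_rotate1:
  assumes "face_walk x ds x" "(d, d') \<in> set (zip ds (rotate1 ds))"
  shows "face (ccw_side d) = face (cw_side d')"
proof -
  obtain i where i: "i < length ds" "d = ds ! i" "d' = ds ! (Suc i mod length ds)"
    using assms(2) by (auto simp: set_zip nth_rotate1)
  moreover have "x = face (cw_side (ds ! 0))" using assms(1) i(1) by (cases ds) auto
  moreover have "Suc i mod length ds = (if Suc i < length ds then Suc i else 0)"
    using i(1) by (cases "Suc i = length ds") auto
  ultimately show ?thesis using face_walk_nth[OF assms(1) i(1)] by simp
qed

lemma face_walk_right_Pos:
  "stacked (outer 0 Tp) x bs y \<Longrightarrow>
     face_walk (x mod n) (map (\<lambda>b. LeftEnd (Pos, v, b)) bs) (y mod n)"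
  by (induction bs arbitrary: x) auto

lemma face_walk_right_Neg:
  "stacked (outer 0 Tm) x bs y \<Longrightarrow>
     face_walk (y mod n) (map (\<lambda>b. LeftEnd (Neg, v, b)) (rev bs)) (x mod n)"
proof (induction bs arbitrary: x)
  case (Cons b bs)
  then show ?case by (auto intro!: face_walk_append[where y = "outer 0 Tm b mod n"])
qed simp

lemma right_neighbours_eq:
  assumes "v < n"
  shows "right_neighbours E Pos v = rights 0 Tp v" "right_neighbours E Neg v = rights 0 Tm v"
proof -
  have "sorted_list_of_set (set (rights 0 T v)) = rights 0 T v" if "leaves T = n" for T
    using sorted_rights[of 0 v T] assms that
    by (simp add: sorted_list_of_set.idem_if_sorted_distinct strict_sorted_iff)
  moreover have "{b. (Pos, v, b) \<in> set E} = set (rights 0 Tp v)"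
    "{b. (Neg, v, b) \<in> set E} = set (rights 0 Tm v)"
    using assms leaves_eq by (auto simp: set_rights E_eq signed_graph_def)
  ultimately show "right_neighbours E Pos v = rights 0 Tp v" "right_neighbours E Neg v = rights 0 Tm v"
    using leaves_eq by (simp_all add: right_neighbours_def)
qed

lemma left_neighbours_eq:
  assumes "0 < v" "v < n"
  obtains a where "left_neighbours E s v = [a]"
proof -
  have "{a. (s, a, v) \<in> set E} = {a. (a, v) \<in> set (arches 0 (if s = Pos then Tp else Tm))}"
    by (cases s) (auto simp: E_eq signed_graph_def)
  then show thesis
    using left_neighbour[of 0 v Tp] left_neighbour[of 0 v Tm] assms leaves_eq that
    by (auto simp: left_neighbours_def split: if_splits)
qed

lemma left_neighbours_0: "left_neighbours E s 0 = []"
proof -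
  have "{a. (s, a, 0) \<in> set E} = {}" using edge_bounds by fastforce
  then show ?thesis by (simp add: left_neighbours_def)
qed

text \<open>The full turn starts in the gap to the right of \<open>v\<close>, climbs through the
  upper right arches to \<open>outer 0 Tp v\<close>, passes the gap \<open>v\<close> between the two
  left arches, and returns from \<open>outer 0 Tm v\<close> through the lower right arches.\<close>

lemma face_walk_rotation:
  assumes "v < n"
  shows "face_walk (Suc v mod n) (rotation E v) (Suc v mod n)"
proof -
  have R: "face_walk (Suc v mod n) (map (\<lambda>b. LeftEnd (Pos, v, b)) (right_neighbours E Pos v))
      (outer 0 Tp v mod n)"
    "face_walk (outer 0 Tm v mod n) (map (\<lambda>b. LeftEnd (Neg, v, b)) (rev (right_neighbours E Neg v)))
      (Suc v mod n)"
    unfolding right_neighbours_eq[OF assms]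
    by (intro face_walk_right_Pos face_walk_right_Neg stacked_rights; use assms leaves_eq in simp)+
  have L: "face_walk (outer 0 Tp v mod n) (map (\<lambda>a. RightEnd (Pos, a, v)) (left_neighbours E Pos v) @
      map (\<lambda>a. RightEnd (Neg, a, v)) (rev (left_neighbours E Neg v))) (outer 0 Tm v mod n)"
  proof (cases "v = 0")
    \<comment> \<open>The vertex 0 has no arches to the left; both outer faces are the unbounded
      one.\<close>
    case True
    then show ?thesis using leaves_eq by (simp add: left_neighbours_0)
  next
    case False
    then obtain a a' where "left_neighbours E Pos v = [a]" "left_neighbours E Neg v = [a']"
      using assms left_neighbours_eq[of v] by (metis neq0_conv)
    then show ?thesis by simp
  qed
  show ?thesis
    using face_walk_append[OF R(1) face_walk_append[OF L R(2)]] by (simp add: rotation_def)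
qed

text \<open>A corner arc cuts off a corner of one face, and a contraction arc follows one side of an
  edge.\<close>

lemma face_arcs_full:
  assumes "(x, y) \<in> arcs (set E)"
  shows "face x = face y"
proof -
  consider v where "v < n" "(x, y) \<in> set (corner_arcs E v)" | e where "(x, y) \<in> contraction_arcs e"
    using assms by (auto simp: arcs_def corners_def state_arcs_def)
  then show ?thesis
  proof cases
    case (1 v)
    from 1(2) show ?thesis
      by (cases rule: corner_arcsE) (auto intro: face_walk_rotate1 face_walk_rotation[OF 1(1)])
  next
    case (2 e)
    obtain s a b where "e = (s, a, b)" by (cases e)
    then show ?thesis using 2 by (cases s) (auto simp: contraction_arcs_def)
  qed
qed

text \<open>All \<open>n\<close> face names occur: \<open>v > 0\<close> below the upper arch ending
  at \<open>v\<close>, and 0 above the upper arch ending at \<open>n - 1\<close>, or on the loop if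
  \<open>n = 1\<close>.\<close>

lemma circles_full_state: "n \<le> circles (arcs (set E))"
proof -
  have face: "(\<exists>x \<in> Field corners. face x = v)" if "v < n" for v
  proof (cases "n = 1")
    case True
    then have "rotation E 0 = []" using length_E by (simp add: set_rotation flip: set_empty)
    then have "Loop 0 \<in> Field corners"
      using n_pos by (force simp: corners_def corner_arcs_def Field_def)
    moreover have "v = 0" using that True by simp
    ultimately show ?thesis using face.simps(3) by blast
  next
    case False
    have edge: "\<exists>a. (Pos, a, b) \<in> set E" if "0 < b" "b < n" for b
      using left_neighbour[of 0 b Tp] that leaves_eq by (auto simp: E_eq signed_graph_def)
    show ?thesis
    proof (cases "v = 0")
      case True
      obtain a where a: "(Pos, a, n - 1) \<in> set E" using edge[of "n - 1"] False n_pos by auto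
      \<comment> \<open>The bounds leave only the value \<open>n\<close>, which is 0 modulo
        \<open>n\<close>.\<close>
      have "n - 1 < outer 0 Tp (n - 1) \<and> outer 0 Tp (n - 1) \<le> 0 + leaves Tp"
        by (rule outer_bounds) (use leaves_eq n_pos in auto)
      then have "outer 0 Tp (n - 1) = n" using leaves_eq(1) by linarith
      then have "face (Strand (Pos, a, n - 1) NW) = v" using True by simp
      then show ?thesis using Strand_in_corners[OF a] by blast
    next
      case False
      then obtain a where a: "(Pos, a, v) \<in> set E" using edge[of v] \<open>v < n\<close> by auto
      have "face (Strand (Pos, a, v) SW) = v" using \<open>v < n\<close> by simp
      then show ?thesis using Strand_in_corners[OF a] by blast
    qed
  qed
  have "n = card {..<n}" by simp
  also have "\<dots> \<le> card (face ` Field (arcs (set E)))"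
    using face finite_corners by (intro card_mono) (force simp: Field_arcs finite_Field)+
  also have "\<dots> \<le> circles (arcs (set E))"
    by (rule card_image_le_circles[OF finite_arcs face_arcs_full])
  finally show ?thesis .
qed

lemma Field_graph_subset: "S \<subseteq> set E \<Longrightarrow> Field (graph n S) = {..<n}"
  by (rule Field_graph) (use edge_bounds in fastforce)

lemma graph_connected: "circles (graph n (set E)) \<le> 1"
proof -
  have "set (arches 0 Tp) \<subseteq> graph n (set E)"
    by (force simp: graph_def E_eq signed_graph_def)
  from joined_mono[OF this] have "(x, 0) \<in> joined (graph n (set E))" if "x < n" for x
    using arches_connected[of 0 x Tp] leaves_eq(1) that by (intro joined_sym[of 0]) (simp add: subsetD)
  then have "circles (graph n (set E)) \<le> card ((\<lambda>_. 0 :: nat) ` Field (graph n (set E)))"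
    by (intro circles_le_card_image[where g = "\<lambda>_. 0"] finite_graph)
      (auto simp: Field_graph_subset)
  also have "\<dots> \<le> card {0 :: nat}" by (intro card_mono) auto
  finally show ?thesis by simp
qed

definition strands :: "label set \<Rightarrow> edge \<Rightarrow> nat" where
  "strands C e = of_bool (Strand e NW \<in> C) + of_bool (Strand e SW \<in> C) +
     of_bool (Strand e SE \<in> C) + of_bool (Strand e NE \<in> C)"

text \<open>
  Each corner arc joins a counterclockwise to a clockwise side and uses each side once, so a
  union of components of the corner arcs contains an even number of strands.
\<close>

lemma even_strands_corners:
  assumes closed: "\<And>x y. (x, y) \<in> corners \<Longrightarrow> x \<in> C \<longleftrightarrow> y \<in> C"
  shows "even (\<Sum>e\<in>set E. strands C e)"
proof -
  let ?f = "\<lambda>d. of_bool (ccw_side d \<in> C) :: nat" and ?g = "\<lambda>d. of_bool (cw_side d \<in> C) :: nat"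
  have vertex: "even (\<Sum>d\<in>set (rotation E v). ?f d + ?g d)" if "v < n" for v
  proof -
    let ?r = "rotation E v"
    have "map ?f ?r = map ?g (rotate1 ?r)"
    proof (rule nth_equalityI)
      fix i assume "i < length (map ?f ?r)"
      then have i: "i < length ?r" by simp
      have "(ccw_side (?r ! i), cw_side (?r ! (Suc i mod length ?r))) \<in> corners"
        using nth_corner_arcs[OF i] that by (auto simp: corners_def)
      from closed[OF this] show "map ?f ?r ! i = map ?g (rotate1 ?r) ! i"
        using i by (simp add: nth_rotate1)
    qed simp
    then have "sum_list (map ?f ?r) = sum_list (map ?g (rotate1 ?r))" by simp
    also have "\<dots> = sum_list (map ?g ?r)"
      by (cases ?r) simp_all
    finally have "(\<Sum>d\<in>set ?r. ?f d) = (\<Sum>d\<in>set ?r. ?g d)"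
      by (simp add: sum_list_distinct_conv_sum_set distinct_rotation)
    then show ?thesis by (simp add: sum.distrib)
  qed
  have "(\<Sum>e\<in>set E. strands C e) =
      (\<Sum>e\<in>set E. (?f (LeftEnd e) + ?g (LeftEnd e)) + (?f (RightEnd e) + ?g (RightEnd e)))"
    by (simp add: strands_def add.assoc)
  also have "\<dots> = (\<Sum>d\<in>LeftEnd ` set E. ?f d + ?g d) + (\<Sum>d\<in>RightEnd ` set E. ?f d + ?g d)"
    unfolding sum.distrib[of "\<lambda>e. ?f (LeftEnd e) + ?g (LeftEnd e)"]
    by (simp add: sum.reindex inj_on_def o_def)
  also have "\<dots> = (\<Sum>d\<in>LeftEnd ` set E \<union> RightEnd ` set E. ?f d + ?g d)"
    by (rule sum.union_disjoint[symmetric]) auto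
  also have "LeftEnd ` set E \<union> RightEnd ` set E = (\<Union>v\<in>{..<n}. set (rotation E v))"
    using edge_bounds by (fastforce simp: set_rotation)
  also have "(\<Sum>d\<in>\<dots>. ?f d + ?g d) = (\<Sum>v<n. \<Sum>d\<in>set (rotation E v). ?f d + ?g d)"
    by (rule sum.UNION_disjoint) (simp, simp, auto simp: set_rotation)
  finally show ?thesis using vertex by (auto intro: dvd_sum)
qed

section \<open>Euler's formula for the states\<close>

lemma state_arcs_insert:
  "state_arcs (insert e F) S =
     (if e \<in> S then contraction_arcs e else deletion_arcs e) \<union> state_arcs F S"
  by (auto simp: state_arcs_def)

text \<open>If \<open>e\<close> closes a cycle, the components stay and at most one circle is
  gained. If it joins two components, the inequality demands that a circle be lost, which a parity
  argument provides.\<close>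

lemma circles_step:
  assumes S: "S \<subseteq> set E" and e: "e \<in> set E" "e \<notin> S"
  shows "circles (arcs (insert e S)) + 2 * circles (graph n S) \<le>
    2 * circles (graph n (insert e S)) + 1 + circles (arcs S)"
proof -
  obtain s a b where sab: "e = (s, a, b)" by (cases e)
  \<comment> \<open>The state with the crossing at \<open>e\<close> left open.\<close>
  define R where "R = corners \<union> state_arcs (set E - {e}) S"
  have E_insert: "set E = insert e (set E - {e})" using e by auto
  have "state_arcs (set E) S = deletion_arcs e \<union> state_arcs (set E - {e}) S"
    by (subst E_insert, subst state_arcs_insert) (simp add: e)
  then have old: "arcs S =
      insert (Strand e NW, Strand e SW) (insert (Strand e NE, Strand e SE) R)"
    by (auto simp: arcs_def R_def deletion_arcs_def)
  have "state_arcs (set E - {e}) (insert e S) = state_arcs (set E - {e}) S"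
    by (auto simp: state_arcs_def)
  then have "state_arcs (set E) (insert e S) = contraction_arcs e \<union> state_arcs (set E - {e}) S"
    by (subst E_insert, subst state_arcs_insert) simp
  then have new: "arcs (insert e S) =
      insert (Strand e NW, Strand e NE) (insert (Strand e SW, Strand e SE) R)"
    by (auto simp: arcs_def R_def contraction_arcs_def)
  have fin: "finite R"
    by (simp add: R_def finite_corners finite_state_arcs)
  have "Field corners \<subseteq> Field R" by (auto simp: R_def Field_Un)
  then have sub: "{Strand e NW, Strand e SW, Strand e NE, Strand e SE} \<subseteq> Field R"
    using Strand_in_corners[OF e(1)] by blast
  have graph: "graph n (insert e S) = insert (a, b) (graph n S)"
    by (simp add: sab graph_insert)
  have ab: "a \<in> Field (graph n S)" "b \<in> Field (graph n S)"
    using edge_bounds[of s a b] e(1) sab S by (auto simp: Field_graph_subset)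
  have fin_graph: "finite (graph n S)" using S finite_graph finite_subset by blast
  show ?thesis
  proof (cases "(a, b) \<in> joined (graph n S)")
    case True
    then have "circles (graph n (insert e S)) = circles (graph n S)"
      unfolding graph using ab by (rule circles_insert_joined)
    moreover have "circles (arcs (insert e S)) \<le> Suc (circles (arcs S))"
      unfolding old new by (rule circles_smoothing_le[OF fin sub])
    ultimately show ?thesis by simp
  next
    case False
    have graph_less: "Suc (circles (graph n (insert e S))) = circles (graph n S)"
      unfolding graph using fin_graph False ab by (rule circles_insert_unjoined)
    \<comment> \<open>Corner and deletion arcs stay at one vertex and contraction arcs follow edges
      of \<open>S\<close>. So the component of the nearby vertex is constant along circles, and
      strands at the two ends of \<open>e\<close> lie on different circles.\<close>
    let ?comp = "\<lambda>x. joined (graph n S) `` {end_vertex x}"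
    have comp: "?comp x = ?comp y" if "(x, y) \<in> arcs S" for x y
    proof -
      have "end_vertex x = end_vertex y \<or> (end_vertex x, end_vertex y) \<in> graph n S"
        using that corner_arcs_end_vertex
        by (auto simp: arcs_def corners_def state_arcs_def contraction_arcs_def deletion_arcs_def
            graph_def split: if_splits) force+
      then show ?thesis by (auto simp: joined_class_eq_iff intro: joined_base)
    qed
    have sep: "(Strand e NW, Strand e NE) \<notin> joined (arcs S)"
      using joined_invariant[of "Strand e NW" "Strand e NE" "arcs S" ?comp, OF _ comp] False
      by (auto simp: sab joined_class_eq_iff)
    have "(Strand e NE, Strand e SE) \<in> joined (arcs S)" by (rule joined_base) (simp add: old)
    then have sep': "(Strand e NW, Strand e SE) \<notin> joined (arcs S)"
      using sep by (meson joined_sym joined_trans)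
    \<comment> \<open>\<open>C\<close> contains an even number of strand ends in total, and an even
      number at every other edge, where they are paired by the state. Hence the number at
      \<open>e\<close> is even; as \<open>NE\<close> and \<open>SE\<close> are excluded,
      \<open>SW\<close> must accompany \<open>NW\<close>.\<close>
    define C where "C = joined R `` {Strand e NW}"
    have closed: "x \<in> C \<longleftrightarrow> y \<in> C" if "(x, y) \<in> R" for x y
      using joined_base[OF that] by (auto simp: C_def intro: joined_trans joined_sym)
    have "joined R \<subseteq> joined (arcs S)" by (rule joined_mono) (auto simp: old)
    with sep sep' have C: "Strand e NE \<notin> C" "Strand e SE \<notin> C" "Strand e NW \<in> C"
      by (auto simp: C_def)
    have "even (strands C e')" if "e' \<in> set E - {e}" for e'
    proof -
      have "(if e' \<in> S then contraction_arcs e' else deletion_arcs e') \<subseteq> R"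
        using that by (auto simp: R_def state_arcs_def)
      then show ?thesis
        using closed[of "Strand e' NW" "Strand e' NE"] closed[of "Strand e' SW" "Strand e' SE"]
          closed[of "Strand e' NW" "Strand e' SW"] closed[of "Strand e' NE" "Strand e' SE"]
        by (auto simp: strands_def contraction_arcs_def deletion_arcs_def split: if_splits)
    qed
    then have "even (\<Sum>e'\<in>set E - {e}. strands C e')" by (rule dvd_sum)
    moreover have "even (\<Sum>e'\<in>set E. strands C e')"
      by (rule even_strands_corners) (rule closed, simp add: R_def)
    moreover have "(\<Sum>e'\<in>set E. strands C e') = strands C e + (\<Sum>e'\<in>set E - {e}. strands C e')"
      by (rule sum.remove) (use e in auto)
    ultimately have "even (strands C e)" by simp
    then have "Strand e SW \<in> C" using C by (auto simp: strands_def)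
    then have "(Strand e NW, Strand e SW) \<in> joined R" by (simp add: C_def)
    then have "Suc (circles (arcs (insert e S))) = circles (arcs S)"
      unfolding old new by (rule circles_smoothing_less[OF fin sub]) (use sep old in simp)
    then show ?thesis using graph_less by simp
  qed
qed

text \<open>
  Euler's formula for the plane subgraph with edge set \<open>S\<close>: the defect is zero for the empty
  subgraph, does not decrease when an edge is added, and is not positive for the whole graph.
\<close>

lemma circles_state:
  assumes "S \<subseteq> set E"
  shows "circles (arcs S) + n = 2 * circles (graph n S) + card S"
proof -
  define defect where
    "defect S = 2 * int (circles (graph n S)) + int (card S) - int n - int (circles (arcs S))" for S
  have mono: "defect S \<le> defect (S \<union> F)" if "finite F" "S \<subseteq> set E" "F \<subseteq> set E" for S F
    using that
  proof (induction F rule: finite_induct)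
    case (insert e F)
    have "defect (S \<union> F) \<le> defect (insert e (S \<union> F))"
    proof (cases "e \<in> S \<union> F")
      case False
      moreover have "finite (S \<union> F)" using insert.prems insert.hyps finite_subset by blast
      ultimately show ?thesis
        using circles_step[of "S \<union> F" e] insert.prems by (simp add: defect_def)
    qed (simp add: insert_absorb)
    then show ?case using insert by simp
  qed simp
  have "0 \<le> defect {}"
    using circles_empty_state by (simp add: defect_def circles_graph_empty)
  also have "\<dots> \<le> defect S" using mono[of S "{}"] assms finite_subset by auto
  finally have "0 \<le> defect S" .
  have "defect S \<le> defect (set E)"
    using mono[of "set E" S] assms by (simp add: Un_absorb1)
  also have "\<dots> \<le> 0"
    \<comment> \<open>There are \<open>2 * n - 2\<close> edges, so the defect is at most
      \<open>2 + (2 * n - 2) - n - n\<close>.\<close>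
    using graph_connected circles_full_state length_E
    by (simp add: defect_def distinct_card[OF distinct_E])
  finally show ?thesis using \<open>0 \<le> defect S\<close> by (simp add: defect_def)
qed

end

section \<open>The state sum\<close>

text \<open>A quarter turn exchanges the two smoothings, so the weights are swapped on negative
  edges.\<close>

fun deletion_weight :: "complex \<Rightarrow> edge \<Rightarrow> complex" where
  "deletion_weight A (Pos, _) = A"
| "deletion_weight A (Neg, _) = inverse A"

fun contraction_weight :: "complex \<Rightarrow> edge \<Rightarrow> complex" where
  "contraction_weight A (Pos, _) = inverse A"
| "contraction_weight A (Neg, _) = A"

text \<open>The arcs produced by \<open>bracket\<close> match the state arcs only up to direction,
  hence the symmetric closures; \<open>circles\<close> does not see the difference.\<close>

lemma bracket_edge_crossing:
  obtains D C where
    "bracket A (edge_crossing e # cs) R =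
       deletion_weight A e * bracket A cs (D @ R) + contraction_weight A e * bracket A cs (C @ R)"
    "set D \<union> (set D)\<inverse> = deletion_arcs e \<union> (deletion_arcs e)\<inverse>"
    "set C \<union> (set C)\<inverse> = contraction_arcs e \<union> (contraction_arcs e)\<inverse>"
proof -
  obtain s ab where e: "e = (s, ab)" by (cases e)
  show thesis
  proof (cases s)
    case Pos
    then show thesis
      using that[of "[(Strand e SW, Strand e NW), (Strand e SE, Strand e NE)]"
          "[(Strand e NW, Strand e NE), (Strand e SW, Strand e SE)]"] e
      by (auto simp: deletion_arcs_def contraction_arcs_def)
  next
    case Neg
    then show thesis
      using that[of "[(Strand e NE, Strand e SE), (Strand e NW, Strand e SW)]"
          "[(Strand e NW, Strand e NE), (Strand e SW, Strand e SE)]"] e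
      by (auto simp: deletion_arcs_def contraction_arcs_def)
  qed
qed

lemma sum_Pow_insert:
  assumes "finite F" "e \<notin> F"
  shows "sum f (Pow (insert e F)) = (\<Sum>S\<in>Pow F. f S + f (insert e S))"
proof -
  have "inj_on (insert e) (Pow F)"
    using assms(2) by (auto simp: inj_on_def)
  moreover have "Pow F \<inter> insert e ` Pow F = {}" using assms(2) by auto
  ultimately show ?thesis
    using assms(1) by (simp add: Pow_insert sum.union_disjoint sum.reindex sum.distrib o_def)
qed

text \<open>A state is the set \<open>S\<close> of contracted edges. Resolving the first crossing
  splits the sum according to whether its edge is in \<open>S\<close>, with the new arcs absorbed
  into the general \<open>R\<close>.\<close>

lemma bracket_state_sum:
  assumes "distinct E"
  shows "bracket A (map edge_crossing E) R =
    (\<Sum>S\<in>Pow (set E). (\<Prod>e\<in>S. contraction_weight A e) * (\<Prod>e\<in>set E - S. deletion_weight A e) *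
       loop_value A ^ (circles (set R \<union> state_arcs (set E) S) - 1))"
  using assms
proof (induction E arbitrary: R)
  case Nil
  then show ?case by (simp add: state_arcs_def)
next
  case (Cons e E)
  then have e: "e \<notin> set E" and dist: "distinct E" by auto
  let ?F = "set E"
  obtain D C where step: "bracket A (edge_crossing e # map edge_crossing E) R =
       deletion_weight A e * bracket A (map edge_crossing E) (D @ R) +
       contraction_weight A e * bracket A (map edge_crossing E) (C @ R)"
    and D: "set D \<union> (set D)\<inverse> = deletion_arcs e \<union> (deletion_arcs e)\<inverse>"
    and C: "set C \<union> (set C)\<inverse> = contraction_arcs e \<union> (contraction_arcs e)\<inverse>"
    by (rule bracket_edge_crossing)
  let ?G = "\<lambda>S. (\<Prod>e\<in>S. contraction_weight A e) * (\<Prod>e\<in>set (e # E) - S. deletion_weight A e) *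
       loop_value A ^ (circles (set R \<union> state_arcs (set (e # E)) S) - 1)"
  have summand: "deletion_weight A e * ((\<Prod>e\<in>S. contraction_weight A e) *
        (\<Prod>e\<in>?F - S. deletion_weight A e) *
        loop_value A ^ (circles (set (D @ R) \<union> state_arcs ?F S) - 1)) = ?G S"
    "contraction_weight A e * ((\<Prod>e\<in>S. contraction_weight A e) *
        (\<Prod>e\<in>?F - S. deletion_weight A e) *
        loop_value A ^ (circles (set (C @ R) \<union> state_arcs ?F S) - 1)) = ?G (insert e S)"
    if "S \<in> Pow ?F" for S
  proof -
    have S: "S \<subseteq> ?F" "e \<notin> S" "finite S" using that e finite_subset[of S ?F] by auto
    have "state_arcs (insert e ?F) S = deletion_arcs e \<union> state_arcs ?F S"
      using S by (auto simp: state_arcs_def split: if_splits)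
    then have "circles (set (D @ R) \<union> state_arcs ?F S) =
        circles (set R \<union> state_arcs (set (e # E)) S)"
      by (intro circles_cong_sym) (use D in auto)
    moreover have "set (e # E) - S = insert e (?F - S)" "e \<notin> ?F - S" using S e by auto
    ultimately show "deletion_weight A e * ((\<Prod>e\<in>S. contraction_weight A e) *
        (\<Prod>e\<in>?F - S. deletion_weight A e) *
        loop_value A ^ (circles (set (D @ R) \<union> state_arcs ?F S) - 1)) = ?G S"
      by (simp add: mult_ac)
    have "state_arcs (insert e ?F) (insert e S) = contraction_arcs e \<union> state_arcs ?F S"
      using S e by (auto simp: state_arcs_def split: if_splits)
    then have "circles (set (C @ R) \<union> state_arcs ?F S) =
        circles (set R \<union> state_arcs (set (e # E)) (insert e S))"
      by (intro circles_cong_sym) (use C in auto)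
    moreover have "set (e # E) - insert e S = ?F - S" using S e by auto
    ultimately show "contraction_weight A e * ((\<Prod>e\<in>S. contraction_weight A e) *
        (\<Prod>e\<in>?F - S. deletion_weight A e) *
        loop_value A ^ (circles (set (C @ R) \<union> state_arcs ?F S) - 1)) = ?G (insert e S)"
      using S by (simp add: mult_ac)
  qed
  have "bracket A (map edge_crossing (e # E)) R = (\<Sum>S\<in>Pow ?F. ?G S + ?G (insert e S))"
    unfolding list.map(2) step Cons.IH[OF dist] sum_distrib_left sum.distrib
    by (intro arg_cong2[where f = "(+)"] sum.cong refl summand)
  also have "\<dots> = sum ?G (Pow (set (e # E)))"
    using e by (simp add: sum_Pow_insert)
  finally show ?case .
qed

definition colourings :: "nat \<Rightarrow> nat \<Rightarrow> (nat \<Rightarrow> nat) set" where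
  "colourings n Q = {..<n} \<rightarrow>\<^sub>E {..<Q}"

lemma finite_colourings: "finite (colourings n Q)"
  by (simp add: colourings_def finite_PiE)

text \<open>The Boltzmann weight of an edge: expanding a product of these chooses deletion or
  contraction at each edge, and contraction requires equal colours at its ends.\<close>

fun potts_weight :: "complex \<Rightarrow> (nat \<Rightarrow> nat) \<Rightarrow> edge \<Rightarrow> complex" where
  "potts_weight A \<sigma> (s, a, b) = deletion_weight A (s, a, b) +
     loop_value A * contraction_weight A (s, a, b) * of_bool (\<sigma> a = \<sigma> b)"

context tree_pair
begin

lemma circles_arcs_pos: "0 < circles (arcs S)"
proof -
  have "corner_arcs E 0 \<noteq> []" by (auto simp: corner_arcs_def zip_eq_Nil_iff)
  then have "arcs S \<noteq> {}" using n_pos by (auto simp: arcs_def corners_def)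
  then show ?thesis using finite_arcs circles_pos by blast
qed

text \<open>The Fortuin-Kasteleyn expansion, read backwards.\<close>

lemma kauffman_bracket_potts:
  assumes "loop_value A ^ 2 = of_nat Q"
  shows "loop_value A ^ Suc n * kauffman_bracket (link_diagram Tp Tm) A =
    (\<Sum>\<sigma>\<in>colourings n Q. \<Prod>e\<in>set E. potts_weight A \<sigma> e)"
proof -
  let ?\<delta> = "loop_value A" and ?c = "contraction_weight A" and ?d = "deletion_weight A"
  define mono where "mono \<sigma> e = (of_bool (\<sigma> (fst (snd e)) = \<sigma> (snd (snd e))) :: complex)"
    for \<sigma> :: "nat \<Rightarrow> nat" and e :: edge
  have corners: "set (concat (map (corner_arcs E) [0..<leaves Tp])) = corners"
    using leaves_eq by (auto simp: corners_def)
  have "kauffman_bracket (link_diagram Tp Tm) A =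
      bracket A (map edge_crossing E) (concat (map (corner_arcs E) [0..<leaves Tp]))"
    by (simp add: kauffman_bracket_def link_diagram_def E_eq Let_def)
  also have "\<dots> = (\<Sum>S\<in>Pow (set E). (\<Prod>e\<in>S. ?c e) * (\<Prod>e\<in>set E - S. ?d e) *
      ?\<delta> ^ (circles (arcs S) - 1))"
    unfolding bracket_state_sum[OF distinct_E] corners arcs_def ..
  also have "?\<delta> ^ Suc n * \<dots> = (\<Sum>S\<in>Pow (set E). \<Sum>\<sigma>\<in>colourings n Q.
      (\<Prod>e\<in>S. ?\<delta> * ?c e * mono \<sigma> e) * (\<Prod>e\<in>set E - S. ?d e))"
    unfolding sum_distrib_left
  proof (rule sum.cong)
    fix S assume "S \<in> Pow (set E)"
    then have S: "S \<subseteq> set E" "finite S" using finite_subset by auto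
    \<comment> \<open>The prefactor is chosen so that Euler's formula makes the exponent
      \<open>2 * circles (graph n S) + card S\<close>. The truncated subtraction is harmless because
      a state has at least one circle.\<close>
    have "?\<delta> ^ Suc n * ?\<delta> ^ (circles (arcs S) - 1) = ?\<delta> ^ (circles (arcs S) + n)"
      using circles_arcs_pos[of S] by (cases "circles (arcs S)") (simp_all add: add.commute flip: power_add)
    also have "\<dots> = of_nat Q ^ circles (graph n S) * ?\<delta> ^ card S"
      unfolding circles_state[OF S(1)] power_add power_mult assms ..
    \<comment> \<open>Here the number of components becomes a count of the colourings constant on
      them.\<close>
    also have "of_nat Q ^ circles (graph n S) =
        (of_nat (card {\<sigma> \<in> colourings n Q. \<forall>(x, y)\<in>graph n S. \<sigma> x = \<sigma> y}) :: complex)"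
      using card_invariant_functions[OF finite_graph[OF S(2)], of n "{..<Q}"]
      by (simp add: Field_graph_subset[OF S(1)] colourings_def)
    also have "\<dots> = (\<Sum>\<sigma>\<in>colourings n Q. of_bool (\<forall>(x, y)\<in>graph n S. \<sigma> x = \<sigma> y))"
      using finite_colourings by (simp add: Int_def sum_of_bool_eq)
    also have "\<dots> = (\<Sum>\<sigma>\<in>colourings n Q. \<Prod>e\<in>S. mono \<sigma> e)"
    proof (rule sum.cong)
      fix \<sigma> :: "nat \<Rightarrow> nat"
      have "(\<forall>(x, y)\<in>graph n S. \<sigma> x = \<sigma> y) \<longleftrightarrow> (\<forall>e\<in>S. \<sigma> (fst (snd e)) = \<sigma> (snd (snd e)))"
        by (auto simp: graph_def split_def)
      moreover have "(\<Prod>e\<in>S. mono \<sigma> e) = of_bool (\<forall>e\<in>S. \<sigma> (fst (snd e)) = \<sigma> (snd (snd e)))"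
        using S(2) by (induction S rule: finite_induct) (simp_all add: mono_def)
      ultimately show "of_bool (\<forall>(x, y)\<in>graph n S. \<sigma> x = \<sigma> y) = (\<Prod>e\<in>S. mono \<sigma> e)" by simp
    qed simp
    finally have power: "?\<delta> ^ Suc n * ?\<delta> ^ (circles (arcs S) - 1) =
        (\<Sum>\<sigma>\<in>colourings n Q. \<Prod>e\<in>S. mono \<sigma> e) * ?\<delta> ^ card S" .
    have "?\<delta> ^ Suc n * ((\<Prod>e\<in>S. ?c e) * (\<Prod>e\<in>set E - S. ?d e) * ?\<delta> ^ (circles (arcs S) - 1)) =
        (\<Prod>e\<in>S. ?c e) * (\<Prod>e\<in>set E - S. ?d e) * (?\<delta> ^ Suc n * ?\<delta> ^ (circles (arcs S) - 1))"
      by (simp only: mult_ac)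
    also have "\<dots> = (\<Sum>\<sigma>\<in>colourings n Q. (\<Prod>e\<in>S. ?\<delta> * ?c e * mono \<sigma> e) * (\<Prod>e\<in>set E - S. ?d e))"
      unfolding power by (simp add: prod.distrib sum_distrib_left sum_distrib_right mult_ac)
    finally show "?\<delta> ^ Suc n * ((\<Prod>e\<in>S. ?c e) * (\<Prod>e\<in>set E - S. ?d e) * ?\<delta> ^ (circles (arcs S) - 1)) =
        (\<Sum>\<sigma>\<in>colourings n Q. (\<Prod>e\<in>S. ?\<delta> * ?c e * mono \<sigma> e) * (\<Prod>e\<in>set E - S. ?d e))" .
  qed simp
  also have "\<dots> = (\<Sum>\<sigma>\<in>colourings n Q. \<Sum>S\<in>Pow (set E).
      (\<Prod>e\<in>S. ?\<delta> * ?c e * mono \<sigma> e) * (\<Prod>e\<in>set E - S. ?d e))"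
    by (rule sum.swap)
  also have "\<dots> = (\<Sum>\<sigma>\<in>colourings n Q. \<Prod>e\<in>set E. ?\<delta> * ?c e * mono \<sigma> e + ?d e)"
    by (simp add: prod_add)
  also have "\<dots> = (\<Sum>\<sigma>\<in>colourings n Q. \<Prod>e\<in>set E. potts_weight A \<sigma> e)"
    by (intro sum.cong prod.cong) (auto simp: mono_def)
  finally show ?thesis .
qed

end


section \<open>The vectors of the Gram matrix\<close>

text \<open>Positive weights are taken for either tree; a tree in the lower half plane contributes
  the complex conjugate.\<close>

definition tree_weight :: "complex \<Rightarrow> (nat \<Rightarrow> nat) \<Rightarrow> nat \<Rightarrow> btree \<Rightarrow> complex" where
  "tree_weight A \<sigma> k T = (\<Prod>e\<leftarrow>arches k T. potts_weight A \<sigma> (Pos, e))"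

lemma tree_weight_simps:
  "tree_weight A \<sigma> k Leaf = 1"
  "tree_weight A \<sigma> k (Node l r) = potts_weight A \<sigma> (Pos, k, k + leaves l) *
     (tree_weight A \<sigma> k l * tree_weight A \<sigma> (k + leaves l) r)"
  by (simp_all add: tree_weight_def)

lemma tree_weight_shift:
  "(\<And>i. i < leaves T \<Longrightarrow> \<sigma> (k + i) = \<sigma>' (k' + i)) \<Longrightarrow>
     tree_weight A \<sigma> k T = tree_weight A \<sigma>' k' T"
proof (induction T arbitrary: k k')
  case (Node l r)
  have "tree_weight A \<sigma> k l = tree_weight A \<sigma>' k' l"
    by (rule Node.IH) (use Node.prems in simp)
  moreover have "tree_weight A \<sigma> (k + leaves l) r = tree_weight A \<sigma>' (k' + leaves l) r"
    by (rule Node.IH) (use Node.prems[of "leaves l + _"] in \<open>simp add: add.assoc\<close>)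
  moreover have "\<sigma> k = \<sigma>' k'" "\<sigma> (k + leaves l) = \<sigma>' (k' + leaves l)"
    using Node.prems[of 0] Node.prems[of "leaves l"] by simp_all
  ultimately show ?case by (simp add: tree_weight_simps)
qed (simp add: tree_weight_simps)

text \<open>A caret at leaf \<open>j\<close> inserts the vertex \<open>Suc (k + j)\<close> with a
  single arch, to \<open>k + j\<close>. The colouring \<open>\<sigma>'\<close> is
  \<open>\<sigma>\<close> with this vertex dropped and the later ones shifted back.\<close>

lemma tree_weight_add_caret:
  assumes "j < leaves T" "\<And>i. i \<le> j \<Longrightarrow> \<sigma>' (k + i) = \<sigma> (k + i)"
    "\<And>i. j < i \<Longrightarrow> i < leaves T \<Longrightarrow> \<sigma>' (k + i) = \<sigma> (Suc (k + i))"
  shows "tree_weight A \<sigma> k (add_caret j T) =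
    potts_weight A \<sigma> (Pos, k + j, Suc (k + j)) * tree_weight A \<sigma>' k T"
  using assms
proof (induction T arbitrary: j k)
  case Leaf
  then show ?case by (simp add: tree_weight_simps)
next
  case (Node l r)
  show ?case
  proof (cases "j < leaves l")
    case True
    have "tree_weight A \<sigma> k (add_caret j l) =
        potts_weight A \<sigma> (Pos, k + j, Suc (k + j)) * tree_weight A \<sigma>' k l"
      by (rule Node.IH) (use True Node.prems in auto)
    moreover have "tree_weight A \<sigma>' (k + leaves l) r = tree_weight A \<sigma> (Suc (k + leaves l)) r"
      by (rule tree_weight_shift)
        (use True Node.prems(3)[of "leaves l + _"] in \<open>simp add: add.assoc\<close>)
    moreover have "\<sigma>' k = \<sigma> k" "\<sigma>' (k + leaves l) = \<sigma> (Suc (k + leaves l))"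
      using Node.prems(2)[of 0] Node.prems(3)[of "leaves l"] True by simp_all
    ultimately show ?thesis using True by (simp add: tree_weight_simps)
  next
    case False
    then have j: "k + leaves l + (j - leaves l) = k + j" by simp
    have "tree_weight A \<sigma> (k + leaves l) (add_caret (j - leaves l) r) =
        potts_weight A \<sigma> (Pos, k + j, Suc (k + j)) * tree_weight A \<sigma>' (k + leaves l) r"
      unfolding j[symmetric]
      by (rule Node.IH)
        (use False Node.prems(1) Node.prems(2)[of "leaves l + _"] Node.prems(3)[of "leaves l + _"]
          in \<open>auto simp: add.assoc\<close>)
    moreover have "tree_weight A \<sigma>' k l = tree_weight A \<sigma> k l"
      by (rule tree_weight_shift) (use False Node.prems(2) in simp)
    moreover have "\<sigma>' k = \<sigma> k" "\<sigma>' (k + leaves l) = \<sigma> (k + leaves l)"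
      using Node.prems(2)[of 0] Node.prems(2)[of "leaves l"] False by simp_all
    ultimately show ?thesis using False by (simp add: tree_weight_simps)
  qed
qed

text \<open>The colour of the inserted vertex \<open>Suc j\<close> is free, so each colouring of the
  remaining vertices arises \<open>Q\<close> times.\<close>

lemma sum_colourings_insert:
  fixes f :: "(nat \<Rightarrow> nat) \<Rightarrow> complex"
  assumes "j < n"
  shows "(\<Sum>\<sigma>\<in>colourings (Suc n) Q. f (\<lambda>i\<in>{..<n}. \<sigma> (if i \<le> j then i else Suc i))) =
    of_nat Q * (\<Sum>\<sigma>\<in>colourings n Q. f \<sigma>)"
proof -
  have "(\<Sum>\<sigma>\<in>colourings (Suc n) Q. f (\<lambda>i\<in>{..<n}. \<sigma> (if i \<le> j then i else Suc i))) =
      (\<Sum>(\<tau>, c)\<in>colourings n Q \<times> {..<Q}. f \<tau>)"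
  proof (rule sum.reindex_bij_witness[where
        i = "\<lambda>(\<tau>, c). \<lambda>i\<in>{..<Suc n}. if i \<le> j then \<tau> i else if i = Suc j then c else \<tau> (i - 1)" and
        j = "\<lambda>\<sigma>. (\<lambda>i\<in>{..<n}. \<sigma> (if i \<le> j then i else Suc i), \<sigma> (Suc j))"])
    fix \<sigma> assume "\<sigma> \<in> colourings (Suc n) Q"
    then have "\<sigma> \<in> {..<Suc n} \<rightarrow>\<^sub>E {..<Q}" by (simp add: colourings_def)
    then have \<sigma>: "\<And>i. i < Suc n \<Longrightarrow> \<sigma> i < Q"
      and undef: "\<And>i. \<not> i < Suc n \<Longrightarrow> \<sigma> i = undefined"
      by (auto simp: PiE_iff extensional_def)
    show "(case (\<lambda>i\<in>{..<n}. \<sigma> (if i \<le> j then i else Suc i), \<sigma> (Suc j)) of (\<tau>, c) \<Rightarrow>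
        \<lambda>i\<in>{..<Suc n}. if i \<le> j then \<tau> i else if i = Suc j then c else \<tau> (i - 1)) = \<sigma>"
      using assms undef by (auto simp: fun_eq_iff restrict_def)
    show "(\<lambda>i\<in>{..<n}. \<sigma> (if i \<le> j then i else Suc i), \<sigma> (Suc j)) \<in> colourings n Q \<times> {..<Q}"
      using assms \<sigma> by (auto simp: colourings_def)
  next
    fix p assume "p \<in> colourings n Q \<times> {..<Q}"
    then obtain \<tau> c where p: "p = (\<tau>, c)" "c < Q" "\<tau> \<in> {..<n} \<rightarrow>\<^sub>E {..<Q}"
      by (auto simp: colourings_def)
    then have \<tau>: "\<And>i. i < n \<Longrightarrow> \<tau> i < Q" and undef: "\<And>i. \<not> i < n \<Longrightarrow> \<tau> i = undefined"
      by (auto simp: PiE_iff extensional_def)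
    show "(\<lambda>\<sigma>. (\<lambda>i\<in>{..<n}. \<sigma> (if i \<le> j then i else Suc i), \<sigma> (Suc j)))
        (case p of (\<tau>, c) \<Rightarrow>
          \<lambda>i\<in>{..<Suc n}. if i \<le> j then \<tau> i else if i = Suc j then c else \<tau> (i - 1)) = p"
      using assms undef by (auto simp: p(1) fun_eq_iff restrict_def)
    show "(case p of (\<tau>, c) \<Rightarrow>
        \<lambda>i\<in>{..<Suc n}. if i \<le> j then \<tau> i else if i = Suc j then c else \<tau> (i - 1)) \<in>
        colourings (Suc n) Q"
      using assms \<tau> p by (auto simp: colourings_def)
  qed auto
  also have "\<dots> = of_nat Q * (\<Sum>\<sigma>\<in>colourings n Q. f \<sigma>)"
    by (simp add: sum.cartesian_product[symmetric] sum_distrib_left)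
  finally show ?thesis .
qed

definition bracket_of :: "complex \<Rightarrow> btree \<Rightarrow> btree \<Rightarrow> complex" where
  "bracket_of A Tp Tm = inverse (loop_value A ^ leaves Tp) * kauffman_bracket (link_diagram Tp Tm) A"

locale potts_parameter =
  fixes A :: complex and Q :: nat
  assumes Q: "Q \<in> {2, 3, 4}"
    and A: "A ^ 2 + inverse (A ^ 2) + complex_of_real (sqrt (real Q)) = 0"
begin

section \<open>Consequences of the equation for \<open>A\<close>\<close>

lemma loop_value_eq: "loop_value A = complex_of_real (sqrt (real Q))"
  using A by (simp add: loop_value_def add_eq_0_iff)

lemma loop_value_square: "loop_value A ^ 2 = of_nat Q"
  by (simp add: loop_value_eq flip: of_real_power)

lemma loop_value_nonzero: "loop_value A \<noteq> 0"
  using Q by (auto simp: loop_value_eq)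

text \<open>Only here \<open>Q \<le> 4\<close> matters: \<open>A\<^sup>2\<close> solves \<open>z\<^sup>2 + s z + 1 = 0\<close> with \<open>\<bar>s\<bar> \<le> 2\<close>.\<close>

lemma norm_A: "cmod A = 1"
proof -
  define s where "s = sqrt (real Q)"
  have s: "0 < s" "s\<^sup>2 \<le> 4" using Q by (auto simp: s_def)
  define z where "z = A ^ 2"
  have z: "z + inverse z + of_real s = 0" using A by (simp add: z_def s_def)
  then have "z \<noteq> 0" using s by auto
  then have "z * z + of_real s * z + 1 = 0"
    using arg_cong[OF z, of "\<lambda>w. w * z"] by (simp add: algebra_simps)
  then have re: "Re z * Re z - Im z * Im z + s * Re z + 1 = 0"
    and im: "2 * Re z * Im z + s * Im z = 0"
    by (simp_all add: complex_eq_iff algebra_simps)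
  have "(Re z)\<^sup>2 + (Im z)\<^sup>2 = 1"
  proof (cases "Im z = 0")
    case False
    then have "2 * Re z + s = 0" using im by (simp flip: distrib_right)
    then have "s = - 2 * Re z" by simp
    then show ?thesis using re by (simp add: power2_eq_square)
  next
    \<comment> \<open>For a real root the discriminant \<open>s\<^sup>2 - 4\<close> is a square and
      not positive, so the root is double.\<close>
    case True
    then have "(2 * Re z + s)\<^sup>2 = s\<^sup>2 - 4" using re by (simp add: power2_eq_square algebra_simps)
    then have "(2 * Re z + s)\<^sup>2 = 0" using s by (smt (verit) zero_le_power2)
    then have "s = - 2 * Re z" by simp
    then show ?thesis using re True by (simp add: power2_eq_square)
  qed
  then have "cmod z = 1" by (simp add: cmod_def)
  then have "(cmod A)\<^sup>2 = 1" by (simp add: z_def norm_power)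
  then show ?thesis by (metis norm_ge_zero one_power2 power2_eq_imp_eq zero_le_one)
qed

lemma A_nonzero: "A \<noteq> 0"
  using norm_A by auto

lemma cnj_A: "cnj A = inverse A"
  using complex_norm_square[of A] norm_A A_nonzero by (simp add: field_simps)

text \<open>The loop value is real, and conjugation exchanges \<open>A\<close> and
  \<open>inverse A\<close>, which are the weights of the two signs.\<close>

lemma potts_weight_Neg: "potts_weight A \<sigma> (Neg, e) = cnj (potts_weight A \<sigma> (Pos, e))"
  by (cases e) (simp add: loop_value_eq cnj_A flip: cnj_A)

text \<open>The weight is \<open>A\<close> for different colours; for equal colours the value of the
  loop makes it collapse to \<open>- (inverse A ^ 3)\<close>.\<close>

lemma norm_potts_weight: "cmod (potts_weight A \<sigma> (Pos, e)) = 1"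
proof -
  obtain a b where e: "e = (a, b)" by (cases e)
  have "A + loop_value A * inverse A = - (inverse A ^ 3)"
    using A_nonzero by (simp add: loop_value_def field_simps power2_eq_square power3_eq_cube)
  then show ?thesis
    using norm_A by (simp add: e norm_power norm_inverse)
qed

lemma potts_weight_times_cnj: "potts_weight A \<sigma> (Pos, e) * cnj (potts_weight A \<sigma> (Pos, e)) = 1"
  using norm_potts_weight[of \<sigma> e] by (simp flip: complex_norm_square del: potts_weight.simps)

text \<open>The exponent collects \<open>n\<close> from the normalization and \<open>Suc n\<close>
  from the Potts expansion; the sum is an inner product of a vector of \<open>Tp\<close> with one of
  \<open>Tm\<close>.\<close>

lemma bracket_of_eq:
  assumes "leaves Tp = n" "leaves Tm = n"
  shows "bracket_of A Tp Tm = inverse (loop_value A ^ (2 * n + 1)) *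
    (\<Sum>\<sigma>\<in>colourings n Q. tree_weight A \<sigma> 0 Tp * cnj (tree_weight A \<sigma> 0 Tm))"
proof -
  interpret tree_pair Tp Tm n "signed_graph Tp Tm"
    by unfold_locales (use assms in simp_all)
  let ?E = "signed_graph Tp Tm"
  have "(\<Prod>e\<in>set ?E. potts_weight A \<sigma> e) = tree_weight A \<sigma> 0 Tp * cnj (tree_weight A \<sigma> 0 Tm)" for \<sigma>
  proof -
    have "(\<Prod>e\<in>set ?E. potts_weight A \<sigma> e) = prod_list (map (potts_weight A \<sigma>) ?E)"
      by (rule prod.distinct_set_conv_list[OF distinct_E])
    also have "\<dots> = tree_weight A \<sigma> 0 Tp *
        prod_list (map (\<lambda>e. cnj (potts_weight A \<sigma> (Pos, e))) (arches 0 Tm))"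
      by (simp add: signed_graph_def tree_weight_def o_def potts_weight_Neg del: potts_weight.simps)
    also have "prod_list (map (\<lambda>e. cnj (potts_weight A \<sigma> (Pos, e))) L) =
        cnj (prod_list (map (\<lambda>e. potts_weight A \<sigma> (Pos, e)) L))" for L
      by (induction L) simp_all
    finally show ?thesis by (simp add: tree_weight_def)
  qed
  then have "loop_value A ^ Suc n * kauffman_bracket (link_diagram Tp Tm) A =
      (\<Sum>\<sigma>\<in>colourings n Q. tree_weight A \<sigma> 0 Tp * cnj (tree_weight A \<sigma> 0 Tm))" (is "_ = ?Z")
    using kauffman_bracket_potts[OF loop_value_square] by simp
  then have "kauffman_bracket (link_diagram Tp Tm) A = inverse (loop_value A ^ Suc n) * ?Z"
    using loop_value_nonzero by (simp add: field_simps)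
  moreover have "inverse (loop_value A ^ n) * inverse (loop_value A ^ Suc n) =
      inverse (loop_value A ^ (2 * n + 1))"
    by (simp add: mult_2 power_add)
  ultimately show ?thesis using assms by (simp add: bracket_of_def mult.assoc[symmetric])
qed

text \<open>The two new arches contribute a unimodular weight and its conjugate, hence 1. The free
  colour of the new vertex contributes \<open>Q\<close>, which the two additional powers of the loop
  value cancel.\<close>

lemma bracket_of_add_caret:
  assumes "leaves Tp = leaves Tm" "k < leaves Tm"
  shows "bracket_of A (add_caret k Tp) (add_caret k Tm) = bracket_of A Tp Tm"
proof -
  define n where "n = leaves Tm"
  define F where "F \<sigma> = tree_weight A \<sigma> 0 Tp * cnj (tree_weight A \<sigma> 0 Tm)" for \<sigma>
  have "tree_weight A \<sigma> 0 (add_caret k Tp) * cnj (tree_weight A \<sigma> 0 (add_caret k Tm)) =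
      F (\<lambda>i\<in>{..<n}. \<sigma> (if i \<le> k then i else Suc i))" (is "_ = F ?\<tau>") for \<sigma>
  proof -
    have "tree_weight A \<sigma> 0 (add_caret k T) =
        potts_weight A \<sigma> (Pos, 0 + k, Suc (0 + k)) * tree_weight A ?\<tau> 0 T" if "leaves T = n" for T
      by (rule tree_weight_add_caret) (use that assms in \<open>auto simp: n_def\<close>)
    then have "tree_weight A \<sigma> 0 (add_caret k Tp) * cnj (tree_weight A \<sigma> 0 (add_caret k Tm)) =
        potts_weight A \<sigma> (Pos, 0 + k, Suc (0 + k)) * cnj (potts_weight A \<sigma> (Pos, 0 + k, Suc (0 + k))) * F ?\<tau>"
      using assms by (simp add: F_def n_def del: potts_weight.simps)
    then show ?thesis by (simp only: potts_weight_times_cnj mult_1)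
  qed
  then have "bracket_of A (add_caret k Tp) (add_caret k Tm) =
      inverse (loop_value A ^ (2 * Suc n + 1)) * (of_nat Q * (\<Sum>\<sigma>\<in>colourings n Q. F \<sigma>))"
    using assms by (simp add: bracket_of_eq[of _ "Suc n"] n_def sum_colourings_insert)
  also have "loop_value A ^ (2 * Suc n + 1) = loop_value A ^ (2 * n + 1) * of_nat Q"
    by (simp add: loop_value_square[symmetric] power2_eq_square)
  also have "inverse (loop_value A ^ (2 * n + 1) * of_nat Q) * (of_nat Q * (\<Sum>\<sigma>\<in>colourings n Q. F \<sigma>)) =
      bracket_of A Tp Tm"
    using assms Q by (auto simp: bracket_of_eq[of _ n] n_def F_def)
  finally show ?thesis .
qed

end


section \<open>Positive type\<close>

text \<open>The carets that refine the second tree are added to the first tree as well. A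
  pair-valued \<open>f\<close> transports the group element and its bracket value
  simultaneously.\<close>

lemma refines_lift:
  assumes "refines V T" "leaves S = leaves T"
    and "\<And>k P M. leaves P = leaves M \<Longrightarrow> k < leaves M \<Longrightarrow> f (add_caret k P) (add_caret k M) = f P M"
  obtains W where "leaves W = leaves V" "f W V = f S T"
proof -
  have "\<exists>W. leaves W = leaves V \<and> f W V = f S T"
    using assms(1,2)
  proof (induction rule: refines.induct)
    case (refines_step U T k)
    then obtain W where "leaves W = leaves U" "f W U = f S T" by blast
    then have "leaves (add_caret k W) = leaves (add_caret k U)"
      "f (add_caret k W) (add_caret k U) = f S T"
      using refines_step.hyps assms(3) by simp_all
    then show ?case by blast
  qed blast
  then show thesis using that by blast
qed

lemma subgroup_thompson:
  "subgroup {thompson_map Tp Tm |Tp Tm. leaves Tp = leaves Tm} (BijGroup {0..1})"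
  (is "subgroup ?H _")
proof
  show "?H \<subseteq> carrier (BijGroup {0..1})"
    by (auto simp: BijGroup_def thompson_map_in_Bij)
  show "\<one>\<^bsub>BijGroup {0..1}\<^esub> \<in> ?H"
    using thompson_map_refl[of Leaf] by (simp add: BijGroup_def) metis
  show "inv\<^bsub>BijGroup {0..1}\<^esub> g \<in> ?H" if "g \<in> ?H" for g
    using that by (auto simp: thompson_map_inv_Bij) (metis)
  show "g \<otimes>\<^bsub>BijGroup {0..1}\<^esub> h \<in> ?H" if gh: "g \<in> ?H" "h \<in> ?H" for g h
  proof -
    obtain Tp Tm where g: "leaves Tp = leaves Tm" "g = thompson_map Tp Tm" using gh(1) by blast
    obtain Sp Sm where h: "leaves Sp = leaves Sm" "h = thompson_map Sp Sm" using gh(2) by blast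
    \<comment> \<open>Both inner trees are replaced by a common refinement, over which the product
      telescopes.\<close>
    obtain U where U: "refines U Tm" "refines U Sp" using common_refinement by blast
    obtain Tp' where Tp': "leaves Tp' = leaves U" "thompson_map Tp' U = g"
      using U(1) g(1) unfolding g(2)
      by (rule refines_lift[where f = thompson_map]) (rule thompson_map_add_caret)
    obtain Sm' where Sm': "leaves Sm' = leaves U" "thompson_map U Sm' = h"
      using U(2) h(1)[symmetric] unfolding h(2)
      \<comment> \<open>The arguments are swapped since the tree to be refined is the first one of
        \<open>h\<close>.\<close>
      by (rule refines_lift[where f = "\<lambda>P M. thompson_map M P"]) (simp_all add: thompson_map_add_caret)
    have "g \<otimes>\<^bsub>BijGroup {0..1}\<^esub> h = thompson_map Tp' Sm'"
      unfolding Tp'(2)[symmetric] Sm'(2)[symmetric] by (rule thompson_map_mult) (simp_all add: Tp' Sm')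
    moreover have "leaves Tp' = leaves Sm'" using Tp' Sm' by simp
    ultimately show ?thesis by blast
  qed
qed

text \<open>This computes the arguments of the matrix entries; the inverse agrees with the one in
  the group of all bijections because the carrier is a subgroup.\<close>

lemma thompson_F_mult_inv:
  assumes "leaves P = leaves U" "leaves S = leaves U"
  shows "thompson_map P U \<otimes>\<^bsub>thompson_F\<^esub> inv\<^bsub>thompson_F\<^esub> (thompson_map S U) = thompson_map P S"
proof -
  have "thompson_map S U \<in> {thompson_map Tp Tm |Tp Tm. leaves Tp = leaves Tm}"
    using assms(2) by (intro CollectI exI conjI) (rule refl)
  then have inv: "inv\<^bsub>thompson_F\<^esub> (thompson_map S U) = thompson_map U S"
    unfolding thompson_F_def using assms(2)
    by (simp only: group.m_inv_consistent[OF group_BijGroup subgroup_thompson] thompson_map_inv_Bij)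
  have mult: "g \<otimes>\<^bsub>thompson_F\<^esub> h = g \<otimes>\<^bsub>BijGroup {0..1}\<^esub> h" for g h
    by (simp add: thompson_F_def)
  show ?thesis
    unfolding inv mult using assms by (intro thompson_map_mult) simp_all
qed

text \<open>The tree found for the earlier elements and the second tree of the next one are refined
  to a common tree, and all pairs are lifted to it.\<close>

lemma common_denominator:
  fixes r :: nat
  assumes "\<forall>i<r. g i \<in> carrier thompson_F"
  obtains U P where "\<And>i. i < r \<Longrightarrow> leaves (P i) = leaves U \<and> g i = thompson_map (P i) U"
proof -
  have "\<exists>U. \<forall>i<r. \<exists>P. leaves P = leaves U \<and> g i = thompson_map P U"
    using assms
  proof (induction r)
    case (Suc r)
    then obtain U where U: "\<forall>i<r. \<exists>P. leaves P = leaves U \<and> g i = thompson_map P U" by auto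
    obtain Tp Tm where T: "leaves Tp = leaves Tm" "g r = thompson_map Tp Tm"
      using Suc.prems by (force simp: thompson_F_def)
    obtain V where V: "refines V U" "refines V Tm" using common_refinement by blast
    have lift: "\<exists>P. leaves P = leaves V \<and> thompson_map S M = thompson_map P V"
      if "refines V M" "leaves S = leaves M" for S M
      using that by (rule refines_lift[where f = thompson_map]) (auto intro: thompson_map_add_caret)
    have "\<exists>P. leaves P = leaves V \<and> g i = thompson_map P V" if i: "i < Suc r" for i
    proof (cases "i = r")
      case True
      then show ?thesis using lift[OF V(2) T(1)] T(2) by simp
    next
      case False
      then have "i < r" using i by simp
      then obtain S where "leaves S = leaves U" "g i = thompson_map S U" using U by blast
      then show ?thesis using lift[OF V(1)] by simp
    qed
    then show ?case by blast
  qed simp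
  then show thesis using that by metis
qed

text \<open>Summing over \<open>x\<close> last, the quadratic form is \<open>\<kappa>\<close> times
  a sum of squared moduli of \<open>\<Sum>i<r. cnj (c i) * w i x\<close>.\<close>

lemma positive_semidefinite_Gram:
  assumes "finite X" "0 \<le> \<kappa>"
    and M: "\<And>i j. i < r \<Longrightarrow> j < r \<Longrightarrow> M i j = complex_of_real \<kappa> * (\<Sum>x\<in>X. w i x * cnj (w j x))"
  shows "positive_semidefinite r M"
  unfolding positive_semidefinite_def
proof (intro conjI allI impI)
  show "M j i = cnj (M i j)" if "i < r" "j < r" for i j
    using that by (simp add: M mult.commute)
  fix c :: "nat \<Rightarrow> complex"
  have "(\<Sum>i<r. \<Sum>j<r. cnj (c i) * M i j * c j) =
      (\<Sum>i<r. \<Sum>j<r. \<Sum>x\<in>X. of_real \<kappa> * ((cnj (c i) * w i x) * (c j * cnj (w j x))))"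
    by (intro sum.cong) (auto simp: M sum_distrib_left sum_distrib_right mult_ac)
  also have "\<dots> = (\<Sum>i<r. \<Sum>x\<in>X. \<Sum>j<r. of_real \<kappa> * ((cnj (c i) * w i x) * (c j * cnj (w j x))))"
    by (intro sum.cong refl sum.swap)
  also have "\<dots> = (\<Sum>x\<in>X. \<Sum>i<r. \<Sum>j<r. of_real \<kappa> * ((cnj (c i) * w i x) * (c j * cnj (w j x))))"
    by (rule sum.swap)
  also have "\<dots> = (\<Sum>x\<in>X. of_real \<kappa> * ((\<Sum>i<r. cnj (c i) * w i x) * cnj (\<Sum>i<r. cnj (c i) * w i x)))"
    unfolding cnj_sum sum_product
    unfolding sum_distrib_left by (intro sum.cong refl) simp
  also have "\<dots> = of_real (\<Sum>x\<in>X. \<kappa> * (cmod (\<Sum>i<r. cnj (c i) * w i x))\<^sup>2)"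
    unfolding of_real_sum of_real_mult complex_norm_square ..
  finally show "0 \<le> Re (\<Sum>i<r. \<Sum>j<r. cnj (c i) * M i j * c j)"
    using assms(2) by (simp add: sum_nonneg)
qed

context potts_parameter
begin

text \<open>Over a common refinement of the second trees the first trees must coincide, so both
  values are the bracket of one and the same pair.\<close>

lemma bracket_of_well_defined:
  assumes "leaves Tp = leaves Tm" "leaves Sp = leaves Sm" "thompson_map Tp Tm = thompson_map Sp Sm"
  shows "bracket_of A Tp Tm = bracket_of A Sp Sm"
proof -
  obtain U where U: "refines U Tm" "refines U Sm" using common_refinement by blast
  let ?f = "\<lambda>P M. (thompson_map P M, bracket_of A P M)"
  obtain Tp' where Tp': "leaves Tp' = leaves U" "?f Tp' U = ?f Tp Tm"
    using U(1) assms(1)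
    by (rule refines_lift[where f = ?f]) (simp add: thompson_map_add_caret bracket_of_add_caret)
  obtain Sp' where Sp': "leaves Sp' = leaves U" "?f Sp' U = ?f Sp Sm"
    using U(2) assms(2)
    by (rule refines_lift[where f = ?f]) (simp add: thompson_map_add_caret bracket_of_add_caret)
  have "Tp' = Sp'"
    using Tp' Sp' assms(3) by (intro thompson_map_inject[of _ U]) simp_all
  then show ?thesis using Tp'(2) Sp'(2) by simp
qed

lemma thompson_bracket_eq:
  assumes "leaves Tp = leaves Tm"
  shows "thompson_bracket A (thompson_map Tp Tm) = bracket_of A Tp Tm"
  unfolding thompson_bracket_def bracket_of_def[symmetric]
proof (rule the_equality)
  show "\<exists>Sp Sm. leaves Sp = leaves Sm \<and> thompson_map Tp Tm = thompson_map Sp Sm \<and>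
      bracket_of A Tp Tm = bracket_of A Sp Sm"
    using assms by (intro exI[of _ Tp] exI[of _ Tm]) simp
  show "z = bracket_of A Tp Tm"
    if "\<exists>Sp Sm. leaves Sp = leaves Sm \<and> thompson_map Tp Tm = thompson_map Sp Sm \<and>
      z = bracket_of A Sp Sm" for z
    using that bracket_of_well_defined[OF assms] by auto
qed

lemma positive_type_thompson_bracket: "positive_type thompson_F (thompson_bracket A)"
  unfolding positive_type_def
proof (intro allI impI)
  fix r and g :: "nat \<Rightarrow> real \<Rightarrow> real"
  assume "\<forall>i<r. g i \<in> carrier thompson_F"
  then obtain U P where P: "\<And>i. i < r \<Longrightarrow> leaves (P i) = leaves U \<and> g i = thompson_map (P i) U"
    by (rule common_denominator) blast
  \<comment> \<open>All \<open>P i\<close> have \<open>n\<close> leaves, so every entry has the same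
    prefactor and is summed over the same colourings.\<close>
  define n where "n = leaves U"
  have \<kappa>: "0 \<le> inverse (sqrt Q ^ (2 * n + 1))"
    by (intro iffD2[OF inverse_nonnegative_iff_nonnegative] zero_le_power) simp
  have "thompson_bracket A (g i \<otimes>\<^bsub>thompson_F\<^esub> inv\<^bsub>thompson_F\<^esub> (g j)) =
      complex_of_real (inverse (sqrt Q ^ (2 * n + 1))) *
      (\<Sum>\<sigma>\<in>colourings n Q. tree_weight A \<sigma> 0 (P i) * cnj (tree_weight A \<sigma> 0 (P j)))"
    if "i < r" "j < r" for i j
  proof -
    have "g i \<otimes>\<^bsub>thompson_F\<^esub> inv\<^bsub>thompson_F\<^esub> (g j) = thompson_map (P i) (P j)"
      using P that by (simp add: thompson_F_mult_inv)
    then show ?thesis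
      using P that by (simp add: thompson_bracket_eq bracket_of_eq[of _ n] n_def loop_value_eq)
  qed
  then show "positive_semidefinite r
      (\<lambda>i j. thompson_bracket A (g i \<otimes>\<^bsub>thompson_F\<^esub> inv\<^bsub>thompson_F\<^esub> (g j)))"
    by (rule positive_semidefinite_Gram[OF finite_colourings, rotated]) (assumption | rule \<kappa>)+
qed

end

theorem theorem5p4:
  fixes Q :: nat and A :: complex
  assumes "Q \<in> {2, 3, 4}"
    and "A ^ 2 + inverse (A ^ 2) + complex_of_real (sqrt (real Q)) = 0"
  shows "positive_type thompson_F (thompson_bracket A)"
proof -
  interpret potts_parameter A Q
    using assms by unfold_locales
  show ?thesis by (rule positive_type_thompson_bracket)
qed

end
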